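(* Let $B$ be the algebra with $D(\mathfrak{D}_4)$-action described in the context (the case $(\alpha,\beta,\gamma,u_1,u_2,u_3,u_4)=(1,1,-1,1,1,1,1)$). Then the following seventeen elements minimally generate the invariant subring $B^{D(\mathfrak{D}_4)}$ as a $\Bbbk$-algebra: $g_1=y_1y_2$, $g_2=z_1z_2$, $g_3=x_1^2x_2^2$, $g_4=x_1^4+x_2^4$, $g_5=y_1^4+y_2^4$, $g_6=z_1^4+z_2^4$, $g_7=(x_1^2-x_2^2)(y_1^2-y_2^2)$, $g_8=(x_1^2+x_2^2)(z_1^2-z_2^2)$, $g_9=(x_1x_2)(x_1^4-x_2^4)$, $g_{10}=(x_1x_2)(x_1^2+x_2^2)(y_1^2-y_2^2)$, $g_{11}=(x_1x_2)(x_1^2-x_2^2)(z_1^2-z_2^2)$, $g_{12}=(x_1x_2)(y_1^2z_1^2+y_2^2z_2^2)$, $g_{13}=(x_1x_2)(y_1^2z_2^2+y_2^2z_1^2)$, $g_{14}=(x_1^4-x_2^4)(y_1^2z_2^2+y_2^2z_1^2)$, $g_{15}=(x_1^2+x_2^2)(y_1^4z_2^2-y_2^4z_1^2)$, $g_{16}=(x_1^2-x_2^2)(y_1^2z_2^4-y_2^2z_1^4)$, $g_{17}=y_1^4z_2^4+y_2^4z_1^4$.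
   Context: Let $\Bbbk=\mathbb{C}$, $i=\sqrt{-1}$, $\mathfrak{D}_4=\langle r,s\mid r^4=e,\ s^2=r^2,\ rsrs^{-1}=e\rangle$. The Drinfeld double $D(G)$ has basis $\{\phi_gh\}$, multiplication $(\phi_g h)(\phi_{g'}h')=\delta_{g,hg'h^{-1}}\phi_g hh'$, comultiplication $\Delta(\phi_gh)=\sum_x\phi_xh\otimes\phi_{x^{-1}g}h$, counit $\epsilon(\phi_gh)=\delta_{g,e}$. A right $D(G)$-module algebra is a $G$-graded algebra with a right $G$-action by algebra automorphisms with $A_x\cdot g\subseteq A_{g^{-1}xg}$, $\phi_x$ projecting onto $A_x$; the invariant subring $A^{D(G)}=\{a:a\cdot h=\epsilon(h)a\ \forall h\}$ consists of the $G$-fixed elements of $A_e$. $B$ is the quotient of $\Bbbk\langle x_1,x_2,y_1,y_2,z_1,z_2\rangle$ by the relations $x_1x_2-x_2x_1$, $y_1y_2-y_2y_1$, $z_1z_2+z_2z_1$, $x_2y_1-y_1x_1$, $x_1y_2+y_2x_2$, $x_2y_2+y_2x_1$, $x_1y_1-y_1x_2$, $x_2z_1-iz_1x_1$, $ix_1z_2-z_2x_2$, $ix_2z_2-z_2x_1$, $x_1z_1-iz_1x_2$, $y_2z_1-z_1y_2$, $y_1z_2-z_2y_1$, $y_1z_1-z_1y_1$, $y_2z_2-z_2y_2$. The $D(\mathfrak{D}_4)$-module algebra structure is given on generators by: $x_1$: grade $s$, $x_1\cdot r=x_2$, $x_1\cdot s=-ix_1$; $x_2$: grade $sr^2$, $x_2\cdot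 r=-x_1$, $x_2\cdot s=ix_2$; $y_1$: grade $sr$, $y_1\cdot r=-y_2$, $y_1\cdot s=y_2$; $y_2$: grade $sr^3$, $y_2\cdot r=-y_1$, $y_2\cdot s=y_1$; $z_1$: grade $sr$, $z_1\cdot r=-iz_2$, $z_1\cdot s=z_2$; $z_2$: grade $sr^3$, $z_2\cdot r=-iz_1$, $z_2\cdot s=-z_1$. *)

theory Defs
  imports Complex_Main
begin

datatype gen = X1 | X2 | Y1 | Y2 | Z1 | Z2

text \<open>Elements of the free algebra k<x1,...,z2> are functions from words to coefficients
  with finite support (finiteness is tracked by fa_fin).\<close>
type_synonym fa = "gen list \<Rightarrow> complex"

definition fa_fin :: "fa \<Rightarrow> bool" where
  "fa_fin p \<longleftrightarrow> finite {w. p w \<noteq> 0}"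

definition fa_add :: "fa \<Rightarrow> fa \<Rightarrow> fa" (infixl "\<oplus>" 65) where
  "p \<oplus> q = (\<lambda>w. p w + q w)"

definition fa_diff :: "fa \<Rightarrow> fa \<Rightarrow> fa" (infixl "\<ominus>" 65) where
  "p \<ominus> q = (\<lambda>w. p w - q w)"

definition fa_mul :: "fa \<Rightarrow> fa \<Rightarrow> fa" (infixl "\<odot>" 70) where
  "p \<odot> q = (\<lambda>w. \<Sum>k\<le>length w. p (take k w) * q (drop k w))"

definition fa_const :: "complex \<Rightarrow> fa" where
  "fa_const c = (\<lambda>w. if w = [] then c else 0)"

definition fa_var :: "gen \<Rightarrow> fa" where
  "fa_var a = (\<lambda>w. if w = [a] then 1 else 0)"

primrec fa_pow :: "fa \<Rightarrow> nat \<Rightarrow> fa" where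
  "fa_pow p 0 = fa_const 1"
| "fa_pow p (Suc n) = p \<odot> fa_pow p n"

abbreviation "x1 \<equiv> fa_var X1"
abbreviation "x2 \<equiv> fa_var X2"
abbreviation "y1 \<equiv> fa_var Y1"
abbreviation "y2 \<equiv> fa_var Y2"
abbreviation "z1 \<equiv> fa_var Z1"
abbreviation "z2 \<equiv> fa_var Z2"

definition B_rels :: "fa list" where
  "B_rels =
    [ x1 \<odot> x2 \<ominus> x2 \<odot> x1,
      y1 \<odot> y2 \<ominus> y2 \<odot> y1,
      z1 \<odot> z2 \<oplus> z2 \<odot> z1,
      x2 \<odot> y1 \<ominus> y1 \<odot> x1,
      x1 \<odot> y2 \<oplus> y2 \<odot> x2,
      x2 \<odot> y2 \<oplus> y2 \<odot> x1,
      x1 \<odot> y1 \<ominus> y1 \<odot> x2,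
      x2 \<odot> z1 \<ominus> fa_const \<i> \<odot> z1 \<odot> x1,
      fa_const \<i> \<odot> x1 \<odot> z2 \<ominus> z2 \<odot> x2,
      fa_const \<i> \<odot> x2 \<odot> z2 \<ominus> z2 \<odot> x1,
      x1 \<odot> z1 \<ominus> fa_const \<i> \<odot> z1 \<odot> x2,
      y2 \<odot> z1 \<ominus> z1 \<odot> y2,
      y1 \<odot> z2 \<ominus> z2 \<odot> y1,
      y1 \<odot> z1 \<ominus> z1 \<odot> y1,
      y2 \<odot> z2 \<ominus> z2 \<odot> y2 ]"

inductive_set B_ideal :: "fa set" where
  rel: "r \<in> set B_rels \<Longrightarrow> r \<in> B_ideal"
| zero: "fa_const 0 \<in> B_ideal"
| add: "p \<in> B_ideal \<Longrightarrow> q \<in> B_ideal \<Longrightarrow> p \<oplus> q \<in> B_ideal"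
| lmul: "fa_fin a \<Longrightarrow> p \<in> B_ideal \<Longrightarrow> a \<odot> p \<in> B_ideal"
| rmul: "fa_fin a \<Longrightarrow> p \<in> B_ideal \<Longrightarrow> p \<odot> a \<in> B_ideal"

definition B_eq :: "fa \<Rightarrow> fa \<Rightarrow> bool" where
  "B_eq p q \<longleftrightarrow> p \<ominus> q \<in> B_ideal"

section \<open>The group (presentation r^4 = e, s^2 = r^2, r s r s^-1 = e)\<close>

text \<open>The element r^k s^j is encoded as (k mod 4, j).  Using s r = r^-1 s and s^2 = r^2:
  r^a s^b r^c s^d = r^(a + (-1)^b c + 2[b and d]) s^(b xor d).\<close>
type_synonym grp = "nat \<times> bool"

definition grp_e :: grp where "grp_e = (0, False)"

definition grp_mult :: "grp \<Rightarrow> grp \<Rightarrow> grp" where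
  "grp_mult g h = (case g of (a, b) \<Rightarrow> case h of (c, d) \<Rightarrow>
      ((a + (if b then 3 * c else c) + (if b \<and> d then 2 else 0)) mod 4, b \<noteq> d))"

definition grp_elems :: "grp set" where
  "grp_elems = {0..<4} \<times> UNIV"

text \<open>Grades: x1: s, x2: s r^2 = r^2 s, y1, z1: s r = r^3 s, y2, z2: s r^3 = r s.\<close>
fun gen_grade :: "gen \<Rightarrow> grp" where
  "gen_grade X1 = (0, True)"
| "gen_grade X2 = (2, True)"
| "gen_grade Y1 = (3, True)"
| "gen_grade Y2 = (1, True)"
| "gen_grade Z1 = (3, True)"
| "gen_grade Z2 = (1, True)"

definition word_grade :: "gen list \<Rightarrow> grp" where
  "word_grade w = foldl grp_mult grp_e (map gen_grade w)"

definition fa_homog_e :: "fa \<Rightarrow> bool" where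
  "fa_homog_e p \<longleftrightarrow> fa_fin p \<and> (\<forall>w. p w \<noteq> 0 \<longrightarrow> word_grade w = grp_e)"

definition fa_subst :: "(gen \<Rightarrow> complex \<times> gen) \<Rightarrow> fa \<Rightarrow> fa" where
  "fa_subst \<sigma> p = (\<lambda>w'. \<Sum>w\<in>{w. p w \<noteq> 0 \<and> map (snd \<circ> \<sigma>) w = w'}.
      prod_list (map (fst \<circ> \<sigma>) w) * p w)"

fun sigma_r :: "gen \<Rightarrow> complex \<times> gen" where
  "sigma_r X1 = (1, X2)"
| "sigma_r X2 = (-1, X1)"
| "sigma_r Y1 = (-1, Y2)"
| "sigma_r Y2 = (-1, Y1)"
| "sigma_r Z1 = (-\<i>, Z2)"
| "sigma_r Z2 = (-\<i>, Z1)"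

fun sigma_s :: "gen \<Rightarrow> complex \<times> gen" where
  "sigma_s X1 = (-\<i>, X1)"
| "sigma_s X2 = (\<i>, X2)"
| "sigma_s Y1 = (1, Y2)"
| "sigma_s Y2 = (1, Y1)"
| "sigma_s Z1 = (1, Z2)"
| "sigma_s Z2 = (-1, Z1)"

text \<open>Right action of r^k s^j: a . (r^k s^j) = ((a . r) ... . r) . s^j.\<close>
definition act :: "fa \<Rightarrow> grp \<Rightarrow> fa" where
  "act p g = (case g of (k, j) \<Rightarrow>
     ((fa_subst sigma_s) ^^ (if j then 1 else 0)) (((fa_subst sigma_r) ^^ k) p))"

text \<open>Lifts of elements of B^{D(G)}: the G-fixed elements of B_e.\<close>
definition B_invariants :: "fa set" where
  "B_invariants = {p. fa_fin p \<and> (\<exists>q. fa_homog_e q \<and> B_eq p q)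
                     \<and> (\<forall>g\<in>grp_elems. B_eq (act p g) p)}"

inductive_set fa_alg :: "fa set \<Rightarrow> fa set" for S :: "fa set" where
  const: "fa_const c \<in> fa_alg S"
| gen: "s \<in> S \<Longrightarrow> s \<in> fa_alg S"
| add: "p \<in> fa_alg S \<Longrightarrow> q \<in> fa_alg S \<Longrightarrow> p \<oplus> q \<in> fa_alg S"
| mul: "p \<in> fa_alg S \<Longrightarrow> q \<in> fa_alg S \<Longrightarrow> p \<odot> q \<in> fa_alg S"

definition B_subalg :: "fa set \<Rightarrow> fa set" where
  "B_subalg S = {p. fa_fin p \<and> (\<exists>q\<in>fa_alg S. B_eq p q)}"

definition gB :: "nat \<Rightarrow> fa" where
  "gB n =
    (if n = 1 then y1 \<odot> y2
     else if n = 2 then z1 \<odot> z2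
     else if n = 3 then fa_pow x1 2 \<odot> fa_pow x2 2
     else if n = 4 then fa_pow x1 4 \<oplus> fa_pow x2 4
     else if n = 5 then fa_pow y1 4 \<oplus> fa_pow y2 4
     else if n = 6 then fa_pow z1 4 \<oplus> fa_pow z2 4
     else if n = 7 then (fa_pow x1 2 \<ominus> fa_pow x2 2) \<odot> (fa_pow y1 2 \<ominus> fa_pow y2 2)
     else if n = 8 then (fa_pow x1 2 \<oplus> fa_pow x2 2) \<odot> (fa_pow z1 2 \<ominus> fa_pow z2 2)
     else if n = 9 then (x1 \<odot> x2) \<odot> (fa_pow x1 4 \<ominus> fa_pow x2 4)
     else if n = 10 then (x1 \<odot> x2) \<odot> (fa_pow x1 2 \<oplus> fa_pow x2 2) \<odot> (fa_pow y1 2 \<ominus> fa_pow y2 2)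
     else if n = 11 then (x1 \<odot> x2) \<odot> (fa_pow x1 2 \<ominus> fa_pow x2 2) \<odot> (fa_pow z1 2 \<ominus> fa_pow z2 2)
     else if n = 12 then (x1 \<odot> x2) \<odot> (fa_pow y1 2 \<odot> fa_pow z1 2 \<oplus> fa_pow y2 2 \<odot> fa_pow z2 2)
     else if n = 13 then (x1 \<odot> x2) \<odot> (fa_pow y1 2 \<odot> fa_pow z2 2 \<oplus> fa_pow y2 2 \<odot> fa_pow z1 2)
     else if n = 14 then (fa_pow x1 4 \<ominus> fa_pow x2 4) \<odot> (fa_pow y1 2 \<odot> fa_pow z2 2 \<oplus> fa_pow y2 2 \<odot> fa_pow z1 2)
     else if n = 15 then (fa_pow x1 2 \<oplus> fa_pow x2 2) \<odot> (fa_pow y1 4 \<odot> fa_pow z2 2 \<ominus> fa_pow y2 4 \<odot> fa_pow z1 2)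
     else if n = 16 then (fa_pow x1 2 \<ominus> fa_pow x2 2) \<odot> (fa_pow y1 2 \<odot> fa_pow z2 4 \<ominus> fa_pow y2 2 \<odot> fa_pow z1 4)
     else if n = 17 then fa_pow y1 4 \<odot> fa_pow z2 4 \<oplus> fa_pow y2 4 \<odot> fa_pow z1 4
     else fa_const 0)"

end

theory Submission
  imports Defs
begin

text \<open>
  Write \<open>Xi = xi\<^sup>2\<close>, \<open>Yi = yi\<^sup>2\<close>, \<open>Zi = zi\<^sup>2\<close>, \<open>u = x1 x2\<close>, \<open>v = y1 y2\<close>, \<open>w = z1 z2\<close>. The element \<open>r\<^sup>2\<close>
  and the grading force an invariant into the part of \<open>B\<close> of even degree in each of the three pairs
  of variables, and this part is commutative, with \<open>X1 X2 = u\<^sup>2\<close>, \<open>Y1 Y2 = v\<^sup>2\<close>, \<open>Z1 Z2 = - w\<^sup>2\<close>.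
  Averaging a monomial of neutral grade over the group gives, up to a scalar and powers of \<open>v\<close>, \<open>w\<close>,
  \<open>u^i (X1^n \<plusminus> X2^n) (Y1^k Zp^m \<plusminus> Y2^k Zq^m)\<close> with \<open>{p, q} = {1, 2}\<close>, \<open>n + k + m\<close> even and signs
  determined by the parities of \<open>i\<close>, \<open>n\<close>, \<open>m\<close>; the linear recurrences for sums of two powers reduce
  these to small exponents, where they are polynomials in the seventeen generators.

  For minimality, each generator is separated from the algebra generated by the others by a linear
  functional on normal form coefficients (with respect to sorted monomials) that behaves like a
  derivation at the augmentation on all products of invariants.
\<close>

section \<open>The free algebra and its quotient\<close>

text \<open>\<open>B\<close> is given only as a quotient by an ideal, so no basis is at hand, and
  each half of the theorem is arranged to need just one half of a basis theorem. Generation needs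
  that sorted monomials span, because averages are computed monomial by monomial. Minimality needs
  that sorted coefficients are well defined modulo the ideal; this comes from an explicit product
  twisted by powers of \<open>\<i>\<close>, under which the coefficients of every relation cancel,
  and it replaces an argument on confluence of rewriting.

  The orbit sums factor because \<open>r^2\<close> acts trivially on the even part and the remaining
  group of order four splits: \<open>rs\<close> exchanges only the two \<open>X\<close>, and
  \<open>s\<close> only the pairs of \<open>Y\<close> and \<open>Z\<close>, up to sign.

  A single coefficient does not separate every generator: \<open>g14\<close> shares monomials with
  \<open>g7 g8\<close>, and likewise \<open>g15\<close>, \<open>g16\<close>, \<open>g17\<close> with
  \<open>g5 g8\<close>, \<open>g6 g7\<close>, \<open>g5 g6\<close>. There two coefficients are
  combined so that these products cancel, and the cancellation rests on symmetries that hold for all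
  products.\<close>

lemma finite_gen: "finite (UNIV :: gen set)"
  by (rule finite_subset[of _ "{X1, X2, Y1, Y2, Z1, Z2}"]) (use gen.exhaust in auto)

lemma finite_words: "finite {w :: gen list. length w = n}"
  using finite_lists_length_eq[of "UNIV :: gen set" n] finite_gen by simp

definition fa_word :: "gen list \<Rightarrow> fa" where
  "fa_word w = (\<lambda>v. if v = w then 1 else 0)"

lemma append_pairs: "{(u, v). u @ v = w} = (\<lambda>k. (take k w, drop k w)) ` {..length w}"
proof (intro equalityI subsetI)
  fix uv assume "uv \<in> {(u, v). u @ v = w}"
  then show "uv \<in> (\<lambda>k. (take k w, drop k w)) ` {..length w}"
    by (intro image_eqI[of _ _ "length (fst uv)"]) auto
qed auto

lemma finite_append_pairs: "finite {(u, v). u @ v = w}"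
  unfolding append_pairs by simp

lemma fa_mul_apply: "(p \<odot> q) w = (\<Sum>(u, v)\<in>{(u, v). u @ v = w}. p u * q v)"
proof -
  have "inj_on (\<lambda>k. (take k w, drop k w)) {..length w}"
    by (intro inj_onI) (metis atMost_iff length_take min.absorb2 prod.inject)
  then show ?thesis
    by (simp add: append_pairs fa_mul_def sum.reindex)
qed

text \<open>Every pair \<open>(u, v)\<close> belongs to exactly one word \<open>u @ v\<close>. The
  interchange serves twice: for multiplicativity of substitutions, where the weight is the product
  of the scalars, and for the product rule of sorted coefficients, where it is
  \<open>word_coef\<close>.\<close>

lemma sum_fa_mul:
  assumes "finite S"
  shows "(\<Sum>w\<in>S. f w * (p \<odot> q) w) = (\<Sum>(u, v)\<in>{(u, v). u @ v \<in> S}. f (u @ v) * (p u * q v))"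
proof -
  have "(\<Sum>w\<in>S. f w * (p \<odot> q) w) = (\<Sum>w\<in>S. \<Sum>(u, v)\<in>{(u, v). u @ v = w}. f (u @ v) * (p u * q v))"
    unfolding fa_mul_apply sum_distrib_left by (intro sum.cong refl) auto
  also have "\<dots> = (\<Sum>x\<in>(SIGMA w:S. {(u, v). u @ v = w}). case x of (w, u, v) \<Rightarrow> f (u @ v) * (p u * q v))"
    using assms finite_append_pairs by (subst sum.Sigma) (auto intro!: sum.cong)
  also have "\<dots> = (\<Sum>(u, v)\<in>{(u, v). u @ v \<in> S}. f (u @ v) * (p u * q v))"
    by (rule sum.reindex_bij_witness[of _ "\<lambda>(u, v). (u @ v, u, v)" snd]) auto
  finally show ?thesis .
qed

lemma fa_mul_assoc: "(p \<odot> q) \<odot> r = p \<odot> (q \<odot> r)"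
proof
  fix w
  have "((p \<odot> q) \<odot> r) w = (\<Sum>x\<in>{(u, v). u @ v = w}. \<Sum>y\<in>{(a, b). a @ b = fst x}. p (fst y) * q (snd y) * r (snd x))"
    by (subst fa_mul_apply) (auto simp: fa_mul_apply sum_distrib_right intro!: sum.cong)
  also have "\<dots> = (\<Sum>z\<in>(SIGMA x:{(u, v). u @ v = w}. {(a, b). a @ b = fst x}).
      p (fst (snd z)) * q (snd (snd z)) * r (snd (fst z)))"
    using finite_append_pairs by (subst sum.Sigma) (auto intro!: sum.cong)
  \<comment> \<open>Both index sets list the splittings of \<open>w\<close> into three words; the
    left or the right part is the one that is cut again.\<close>
  also have "\<dots> = (\<Sum>z\<in>(SIGMA x:{(u, v). u @ v = w}. {(a, b). a @ b = snd x}).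
      p (fst (fst z)) * (q (fst (snd z)) * r (snd (snd z))))"
    by (rule sum.reindex_bij_witness[of _ "\<lambda>((a, b), (c, d)). ((a @ c, d), (a, c))"
          "\<lambda>((a, b), (c, d)). ((c, d @ b), (d, b))"]) (auto simp: mult.assoc)
  also have "\<dots> = (\<Sum>x\<in>{(u, v). u @ v = w}. \<Sum>y\<in>{(a, b). a @ b = snd x}. p (fst x) * (q (fst y) * r (snd y)))"
    using finite_append_pairs by (subst sum.Sigma) (auto intro!: sum.cong)
  also have "\<dots> = (p \<odot> (q \<odot> r)) w"
    by (subst fa_mul_apply) (auto simp: fa_mul_apply sum_distrib_left intro!: sum.cong)
  finally show "((p \<odot> q) \<odot> r) w = (p \<odot> (q \<odot> r)) w" .
qed

lemma fa_mul_distrib: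
  "(p \<oplus> q) \<odot> r = p \<odot> r \<oplus> q \<odot> r" "p \<odot> (q \<oplus> r) = p \<odot> q \<oplus> p \<odot> r"
  "(p \<ominus> q) \<odot> r = p \<odot> r \<ominus> q \<odot> r" "p \<odot> (q \<ominus> r) = p \<odot> q \<ominus> p \<odot> r"
  by (simp_all add: fa_mul_def fa_add_def fa_diff_def algebra_simps sum.distrib sum_subtractf)

lemma fa_const_mul: "fa_const c \<odot> p = (\<lambda>w. c * p w)" "p \<odot> fa_const c = (\<lambda>w. p w * c)"
proof -
  have "(\<Sum>k\<le>length w. (if w = [] \<or> k = 0 then c else 0) * p (drop k w)) = c * p w"
    "(\<Sum>k\<le>length w. p (take k w) * (if length w \<le> k then c else 0)) = p w * c" for w :: "gen list"
  proof -
    have "(\<Sum>k\<le>length w. (if w = [] \<or> k = 0 then c else 0) * p (drop k w)) =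
        (\<Sum>k\<le>length w. if k = 0 then c * p w else 0)"
      by (intro sum.cong) auto
    then show "(\<Sum>k\<le>length w. (if w = [] \<or> k = 0 then c else 0) * p (drop k w)) = c * p w"
      by simp
    have "(\<Sum>k\<le>length w. p (take k w) * (if length w \<le> k then c else 0)) =
        (\<Sum>k\<le>length w. if k = length w then p w * c else 0)"
      by (intro sum.cong) auto
    then show "(\<Sum>k\<le>length w. p (take k w) * (if length w \<le> k then c else 0)) = p w * c"
      by simp
  qed
  then show "fa_const c \<odot> p = (\<lambda>w. c * p w)" "p \<odot> fa_const c = (\<lambda>w. p w * c)"
    by (auto simp: fa_mul_def fa_const_def fun_eq_iff disj_commute)
qed

lemma fa_word_mul: "fa_word u \<odot> fa_word v = fa_word (u @ v)"
proof
  fix w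
  have "(fa_word u \<odot> fa_word v) w = (\<Sum>x\<in>{(u, v). u @ v = w}. if x = (u, v) then 1 else 0)"
    unfolding fa_mul_apply by (intro sum.cong) (auto simp: fa_word_def split: if_splits)
  then show "(fa_word u \<odot> fa_word v) w = fa_word (u @ v) w"
    by (auto simp: finite_append_pairs fa_word_def)
qed

lemma fa_var_word: "fa_var a = fa_word [a]"
  by (simp add: fa_var_def fa_word_def)

lemma fa_const_word: "fa_const 1 = fa_word []"
  by (simp add: fa_const_def fa_word_def)

lemma fa_fin_simps [simp]: "fa_fin (fa_const c)" "fa_fin (fa_word w)" "fa_fin (fa_var a)"
  by (auto simp: fa_fin_def fa_const_def fa_word_def fa_var_def)

lemma fa_fin_add [simp]: "fa_fin p \<Longrightarrow> fa_fin q \<Longrightarrow> fa_fin (p \<oplus> q)"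
  unfolding fa_fin_def fa_add_def
  by (rule finite_subset[of _ "{w. p w \<noteq> 0} \<union> {w. q w \<noteq> 0}"]) auto

lemma fa_fin_diff [simp]: "fa_fin p \<Longrightarrow> fa_fin q \<Longrightarrow> fa_fin (p \<ominus> q)"
  unfolding fa_fin_def fa_diff_def
  by (rule finite_subset[of _ "{w. p w \<noteq> 0} \<union> {w. q w \<noteq> 0}"]) auto

lemma fa_mul_nonzero:
  assumes "(p \<odot> q) w \<noteq> 0"
  shows "\<exists>u v. w = u @ v \<and> p u \<noteq> 0 \<and> q v \<noteq> 0"
proof (rule ccontr)
  assume "\<not> ?thesis"
  then have "(p \<odot> q) w = 0"
    unfolding fa_mul_apply by (intro sum.neutral) auto
  with assms show False by simp
qed

lemma fa_fin_mul [simp]: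
  assumes "fa_fin p" "fa_fin q"
  shows "fa_fin (p \<odot> q)"
proof -
  have "{w. (p \<odot> q) w \<noteq> 0} \<subseteq> (\<lambda>(u, v). u @ v) ` ({w. p w \<noteq> 0} \<times> {w. q w \<noteq> 0})"
    by (force dest: fa_mul_nonzero)
  then show ?thesis
    using assms unfolding fa_fin_def by (blast intro: finite_subset)
qed

lemma fa_fin_pow [simp]: "fa_fin p \<Longrightarrow> fa_fin (fa_pow p n)"
  by (induction n) auto

section \<open>Congruence modulo the relations and the quotient ring\<close>

lemma fa_fin_ideal: "p \<in> B_ideal \<Longrightarrow> fa_fin p"
  by (induction rule: B_ideal.induct) (auto simp: B_rels_def)

text \<open>The relations are homogeneous of degree 2. This is what gives
  \<open>0 \<noteq> 1\<close> in the quotient.\<close>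

lemma ideal_constant_term: "p \<in> B_ideal \<Longrightarrow> p [] = 0"
  by (induction rule: B_ideal.induct)
    (auto simp: B_rels_def fa_diff_def fa_add_def fa_mul_def fa_var_def fa_const_def)

lemma fa_diff_zero: "p \<ominus> fa_const 0 = p" "p \<ominus> p = fa_const 0"
  by (auto simp: fa_diff_def fa_const_def fun_eq_iff)

lemma ideal_smult: "p \<in> B_ideal \<Longrightarrow> (\<lambda>w. c * p w) \<in> B_ideal"
  using B_ideal.lmul[of "fa_const c" p] by (simp add: fa_const_mul)

lemma B_eq_refl: "B_eq p p"
  by (simp add: B_eq_def fa_diff_zero B_ideal.zero)

lemma B_eq_sym: "B_eq p q \<Longrightarrow> B_eq q p"
  using ideal_smult[of "p \<ominus> q" "-1"] by (simp add: B_eq_def fa_diff_def)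

lemma B_eq_trans: "B_eq p q \<Longrightarrow> B_eq q r \<Longrightarrow> B_eq p r"
  using B_ideal.add[of "p \<ominus> q" "q \<ominus> r"] by (simp add: B_eq_def fa_diff_def fa_add_def)

lemma B_eq_add: "B_eq p p' \<Longrightarrow> B_eq q q' \<Longrightarrow> B_eq (p \<oplus> q) (p' \<oplus> q')"
  using B_ideal.add[of "p \<ominus> p'" "q \<ominus> q'"] by (simp add: B_eq_def fa_diff_def fa_add_def algebra_simps)

lemma B_eq_smult: "B_eq p p' \<Longrightarrow> B_eq (\<lambda>w. c * p w) (\<lambda>w. c * p' w)"
  using ideal_smult[of "p \<ominus> p'" c] by (simp add: B_eq_def fa_diff_def algebra_simps)

lemma B_eq_uminus: "B_eq p p' \<Longrightarrow> B_eq (\<lambda>w. - p w) (\<lambda>w. - p' w)"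
  using B_eq_smult[of p p' "-1"] by simp

lemma B_eq_diff: "B_eq p p' \<Longrightarrow> B_eq q q' \<Longrightarrow> B_eq (p \<ominus> q) (p' \<ominus> q')"
  using B_eq_add[OF _ B_eq_uminus] by (fastforce simp: fa_diff_def fa_add_def)

text \<open>The difference telescopes as \<open>p (q - q') + (p - p') q'\<close>, and the ideal
  absorbs finitely supported factors, here \<open>p\<close> and \<open>q'\<close>.\<close>

lemma B_eq_mul:
  assumes "B_eq p p'" "B_eq q q'" "fa_fin p" "fa_fin q'"
  shows "B_eq (p \<odot> q) (p' \<odot> q')"
proof -
  have "p \<odot> (q \<ominus> q') \<oplus> (p \<ominus> p') \<odot> q' \<in> B_ideal"
    using assms unfolding B_eq_def by (intro B_ideal.add B_ideal.lmul B_ideal.rmul)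
  also have "p \<odot> (q \<ominus> q') \<oplus> (p \<ominus> p') \<odot> q' = p \<odot> q \<ominus> p' \<odot> q'"
    by (simp add: fa_mul_distrib) (simp add: fa_add_def fa_diff_def)
  finally show ?thesis by (simp add: B_eq_def)
qed

\<comment> \<open>The type \<open>fa\<close> contains functions of infinite support, for which the
  ideal rules give no absorption; the partial quotient restricts the congruence to the genuine free
  algebra.\<close>
quotient_type balg = fa / partial: "\<lambda>p q. fa_fin p \<and> fa_fin q \<and> B_eq p q"
proof (rule part_equivpI)
  show "\<exists>p. fa_fin p \<and> fa_fin p \<and> B_eq p p"
    by (intro exI[of _ "fa_const 0"]) (simp add: B_eq_refl)
qed (auto intro!: sympI transpI intro: B_eq_sym B_eq_trans)

instantiation balg :: ring_1
begin

lift_definition zero_balg :: balg is "fa_const 0" by (simp add: B_eq_refl)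
lift_definition one_balg :: balg is "fa_const 1" by (simp add: B_eq_refl)
lift_definition plus_balg :: "balg \<Rightarrow> balg \<Rightarrow> balg" is "(\<oplus>)" by (simp add: B_eq_add)
lift_definition minus_balg :: "balg \<Rightarrow> balg \<Rightarrow> balg" is "(\<ominus>)" by (simp add: B_eq_diff)
lift_definition uminus_balg :: "balg \<Rightarrow> balg" is "\<lambda>p w. - p w"
  by (simp add: B_eq_uminus fa_fin_def)
lift_definition times_balg :: "balg \<Rightarrow> balg \<Rightarrow> balg" is "(\<odot>)" by (simp add: B_eq_mul)

instance
proof
  fix a b c :: balg
  show "a * b * c = a * (b * c)" by transfer (simp add: fa_mul_assoc B_eq_refl)
  show "1 * a = a" "a * 1 = a" by (transfer; simp add: fa_const_mul B_eq_refl)+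
  show "a + b + c = a + (b + c)" "a + b = b + a"
    by (transfer; simp add: fa_add_def add_ac B_eq_refl fa_fin_add[unfolded fa_add_def])+
  show "0 + a = a" by transfer (simp add: fa_add_def fa_const_def B_eq_refl)
  show "- a + a = 0"
    by transfer (simp add: fa_add_def fa_const_def[of 0, simplified, symmetric] B_eq_refl)
  show "a - b = a + - b"
    by transfer (auto simp: fa_diff_def fa_add_def B_eq_refl fa_fin_diff[unfolded fa_diff_def])
  show "(a + b) * c = a * c + b * c" "a * (b + c) = a * b + a * c"
    by (transfer; simp add: fa_mul_distrib B_eq_refl)+
  show "(0 :: balg) \<noteq> 1"
    by transfer (auto simp: B_eq_def fa_diff_def fa_const_def dest: ideal_constant_term)
qed

end

abbreviation cls :: "fa \<Rightarrow> balg" where "cls \<equiv> abs_balg"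

lemma cls_eq_iff: "fa_fin p \<Longrightarrow> fa_fin q \<Longrightarrow> cls p = cls q \<longleftrightarrow> B_eq p q"
  using Quotient3_rel[OF Quotient3_balg, of p q] by (simp add: B_eq_refl)

lemma cls_eq_0_iff: "fa_fin p \<Longrightarrow> cls p = 0 \<longleftrightarrow> p \<in> B_ideal"
  using cls_eq_iff[of p "fa_const 0"] by (simp add: zero_balg_def B_eq_def fa_diff_zero)

lemma cls_surj: "\<exists>p. fa_fin p \<and> b = cls p"
  using Quotient3_rep_reflp[OF Quotient3_balg, of b] Quotient3_abs_rep[OF Quotient3_balg, of b]
  by (intro exI[of _ "rep_balg b"]) simp

lemma cls_add [simp]: "fa_fin p \<Longrightarrow> fa_fin q \<Longrightarrow> cls (p \<oplus> q) = cls p + cls q"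
  by (simp add: plus_balg.abs_eq B_eq_refl)

lemma cls_diff [simp]: "fa_fin p \<Longrightarrow> fa_fin q \<Longrightarrow> cls (p \<ominus> q) = cls p - cls q"
  by (simp add: minus_balg.abs_eq B_eq_refl)

lemma cls_mul [simp]: "fa_fin p \<Longrightarrow> fa_fin q \<Longrightarrow> cls (p \<odot> q) = cls p * cls q"
  by (simp add: times_balg.abs_eq B_eq_refl)

definition scal :: "complex \<Rightarrow> balg" where "scal c = cls (fa_const c)"

definition gn :: "gen \<Rightarrow> balg" where "gn a = cls (fa_var a)"

lemma cls_simps [simp]: "cls (fa_const c) = scal c" "cls (fa_var a) = gn a"
  by (simp_all add: scal_def gn_def)

lemma scal_simps [simp]: "scal 0 = 0" "scal 1 = 1"
  unfolding scal_def zero_balg_def one_balg_def by (rule refl)+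

lemma cls_pow [simp]: "fa_fin p \<Longrightarrow> cls (fa_pow p n) = cls p ^ n"
  by (induction n) auto

lemma scal_mult [simp]: "scal c * scal d = scal (c * d)"
proof -
  have "fa_const c \<odot> fa_const d = fa_const (c * d)"
    unfolding fa_const_mul by (auto simp: fa_const_def)
  then show ?thesis using cls_mul[of "fa_const c" "fa_const d"] by simp
qed

lemma scal_add: "scal (c + d) = scal c + scal d"
proof -
  have "fa_const c \<oplus> fa_const d = fa_const (c + d)"
    by (auto simp: fa_add_def fa_const_def)
  then show ?thesis using cls_add[of "fa_const c" "fa_const d"] by simp
qed

lemma scal_uminus [simp]: "scal (- c) = - scal c"
  using scal_add[of "- c" c] by (simp add: eq_neg_iff_add_eq_0)

lemma scal_commute: "b * scal c = scal c * b"
proof -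
  obtain p where p: "fa_fin p" "b = cls p" using cls_surj by blast
  have "p \<odot> fa_const c = fa_const c \<odot> p"
    by (simp add: fa_const_mul mult.commute)
  then show ?thesis using p cls_mul[of p "fa_const c"] cls_mul[of "fa_const c" p] by simp
qed

lemma scal_move_left [simp]: "scal c * (scal d * b) = scal (c * d) * b"
  "gn a * scal c = scal c * gn a" "gn a * (scal c * b) = scal c * (gn a * b)"
  by (simp_all add: scal_commute[of "gn a"] flip: mult.assoc)

lemma cls_sum_words:
  assumes "fa_fin p"
  shows "cls p = (\<Sum>w | p w \<noteq> 0. scal (p w) * cls (fa_word w))"
proof -
  \<comment> \<open>The induction runs over truncations of \<open>p\<close>; finiteness of the
    support is carried along because additivity of \<open>cls\<close> asks for it.\<close>
  have "cls (\<lambda>w. if w \<in> S then p w else 0) = (\<Sum>w\<in>S. scal (p w) * cls (fa_word w))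
     \<and> fa_fin (\<lambda>w. if w \<in> S then p w else 0)" if "finite S" for S
    using that
  proof (induction S rule: finite_induct)
    case empty
    show ?case by (simp add: zero_balg.abs_eq fa_const_def fa_fin_def)
  next
    case (insert x S)
    have "(\<lambda>w. if w \<in> insert x S then p w else 0) = (fa_const (p x) \<odot> fa_word x) \<oplus> (\<lambda>w. if w \<in> S then p w else 0)"
      using insert.hyps by (auto simp: fa_const_mul fa_add_def fa_word_def)
    then show ?case using insert by simp
  qed
  moreover have "(\<lambda>w. if w \<in> {w. p w \<noteq> 0} then p w else 0) = p" by auto
  ultimately show ?thesis using assms unfolding fa_fin_def by metis
qed

lemma cls_word_Cons: "cls (fa_word (a # w)) = gn a * cls (fa_word w)"
  using fa_word_mul[of "[a]" w] by (metis append_Cons append_Nil cls_mul cls_simps(2) fa_fin_simps(2,3) fa_var_word)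

lemma cls_word_Nil: "cls (fa_word []) = 1"
  by (simp flip: fa_const_word)

text \<open>The relations are solved for the unsorted product. Read from left to right they move
  \<open>x\<close> before \<open>y\<close> before \<open>z\<close> and index 1 before index 2; an
  \<open>x\<close> that passes a \<open>y\<close> or a \<open>z\<close> changes its index.\<close>

lemma B_relations:
  "gn X2 * gn X1 = gn X1 * gn X2" "gn Y2 * gn Y1 = gn Y1 * gn Y2" "gn Z2 * gn Z1 = - (gn Z1 * gn Z2)"
  "gn Y1 * gn X1 = gn X2 * gn Y1" "gn Y1 * gn X2 = gn X1 * gn Y1"
  "gn Y2 * gn X1 = - (gn X2 * gn Y2)" "gn Y2 * gn X2 = - (gn X1 * gn Y2)"
  "gn Z1 * gn X1 = - (scal \<i> * (gn X2 * gn Z1))" "gn Z1 * gn X2 = - (scal \<i> * (gn X1 * gn Z1))"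
  "gn Z2 * gn X1 = scal \<i> * (gn X2 * gn Z2)" "gn Z2 * gn X2 = scal \<i> * (gn X1 * gn Z2)"
  "gn Z1 * gn Y1 = gn Y1 * gn Z1" "gn Z1 * gn Y2 = gn Y2 * gn Z1"
  "gn Z2 * gn Y1 = gn Y1 * gn Z2" "gn Z2 * gn Y2 = gn Y2 * gn Z2"
proof -
  have "cls r = 0" if "r \<in> set B_rels" for r
    using cls_eq_0_iff B_ideal.rel[OF that] fa_fin_ideal by blast
  then have R: "\<forall>r\<in>set B_rels. cls r = 0" by blast
  have ii: "a = - (scal \<i> * b)" if "scal \<i> * a = b" for a b
  proof -
    have "scal \<i> * (scal \<i> * a) = scal \<i> * b" using that by simp
    then have "- a = scal \<i> * b" by simp
    then show ?thesis by (metis minus_minus)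
  qed
  note R' = R[unfolded B_rels_def, simplified, unfolded mult.assoc]
  show "gn X2 * gn X1 = gn X1 * gn X2" "gn Y2 * gn Y1 = gn Y1 * gn Y2"
    "gn Y1 * gn X1 = gn X2 * gn Y1" "gn Y1 * gn X2 = gn X1 * gn Y1"
    "gn Z2 * gn X1 = scal \<i> * (gn X2 * gn Z2)" "gn Z2 * gn X2 = scal \<i> * (gn X1 * gn Z2)"
    "gn Z1 * gn Y1 = gn Y1 * gn Z1" "gn Z1 * gn Y2 = gn Y2 * gn Z1"
    "gn Z2 * gn Y1 = gn Y1 * gn Z2" "gn Z2 * gn Y2 = gn Y2 * gn Z2"
    using R' by simp_all
  show "gn Z2 * gn Z1 = - (gn Z1 * gn Z2)"
    "gn Y2 * gn X1 = - (gn X2 * gn Y2)" "gn Y2 * gn X2 = - (gn X1 * gn Y2)"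
    unfolding eq_neg_iff_add_eq_0 using R' by (simp_all add: add.commute)
  show "gn Z1 * gn X1 = - (scal \<i> * (gn X2 * gn Z1))" "gn Z1 * gn X2 = - (scal \<i> * (gn X1 * gn Z1))"
    by (rule ii, use R' in simp)+
qed

lemma B_relations_assoc:
  "gn X2 * (gn X1 * b) = gn X1 * (gn X2 * b)" "gn Y2 * (gn Y1 * b) = gn Y1 * (gn Y2 * b)"
  "gn Z2 * (gn Z1 * b) = - (gn Z1 * (gn Z2 * b))"
  "gn Y1 * (gn X1 * b) = gn X2 * (gn Y1 * b)" "gn Y1 * (gn X2 * b) = gn X1 * (gn Y1 * b)"
  "gn Y2 * (gn X1 * b) = - (gn X2 * (gn Y2 * b))" "gn Y2 * (gn X2 * b) = - (gn X1 * (gn Y2 * b))"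
  "gn Z1 * (gn X1 * b) = - (scal \<i> * (gn X2 * (gn Z1 * b)))"
  "gn Z1 * (gn X2 * b) = - (scal \<i> * (gn X1 * (gn Z1 * b)))"
  "gn Z2 * (gn X1 * b) = scal \<i> * (gn X2 * (gn Z2 * b))"
  "gn Z2 * (gn X2 * b) = scal \<i> * (gn X1 * (gn Z2 * b))"
  "gn Z1 * (gn Y1 * b) = gn Y1 * (gn Z1 * b)" "gn Z1 * (gn Y2 * b) = gn Y2 * (gn Z1 * b)"
  "gn Z2 * (gn Y1 * b) = gn Y1 * (gn Z2 * b)" "gn Z2 * (gn Y2 * b) = gn Y2 * (gn Z2 * b)"
  by (simp_all add: B_relations flip: mult.assoc)

text \<open>These rules sort concrete words; the second family reaches into right-nested products.
  The finite checks on relations and generators rest on them.\<close>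

lemmas sort_simps = B_relations B_relations_assoc mult.assoc

section \<open>Substitutions and the actions of \<open>r\<close> and \<open>s\<close> on the
  quotient\<close>

lemma finite_map_preimage: "finite {w. map f w = (v :: gen list)}" for f :: "gen \<Rightarrow> gen"
  by (rule finite_subset[OF _ finite_words[of "length v"]]) auto

text \<open>Dropping the support condition makes the formula linear in \<open>p\<close>; the sum
  stays finite since \<open>map\<close> preserves length.\<close>

lemma fa_subst_apply:
  "fa_subst \<sigma> p v = (\<Sum>w | map (snd \<circ> \<sigma>) w = v. prod_list (map (fst \<circ> \<sigma>) w) * p w)"
  unfolding fa_subst_def
  by (rule sum.mono_neutral_left[OF finite_map_preimage]) auto

lemma fa_subst_add [simp]: "fa_subst \<sigma> (p \<oplus> q) = fa_subst \<sigma> p \<oplus> fa_subst \<sigma> q"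
  by (simp add: fa_subst_apply fun_eq_iff fa_add_def algebra_simps sum.distrib)

lemma fa_subst_diff [simp]: "fa_subst \<sigma> (p \<ominus> q) = fa_subst \<sigma> p \<ominus> fa_subst \<sigma> q"
  by (simp add: fa_subst_apply fun_eq_iff fa_diff_def algebra_simps sum_subtractf)

lemma fa_subst_const [simp]: "fa_subst \<sigma> (fa_const c) = fa_const c"
proof
  fix v
  have "{w. fa_const c w \<noteq> 0 \<and> map (snd \<circ> \<sigma>) w = v} = (if v = [] \<and> c \<noteq> 0 then {[]} else {})"
    by (auto simp: fa_const_def split: if_splits)
  then show "fa_subst \<sigma> (fa_const c) v = fa_const c v"
    by (auto simp: fa_subst_def fa_const_def)
qed

lemma fa_subst_var [simp]: "fa_subst \<sigma> (fa_var a) = fa_const (fst (\<sigma> a)) \<odot> fa_var (snd (\<sigma> a))"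
proof
  fix v
  have "{w. fa_var a w \<noteq> 0 \<and> map (snd \<circ> \<sigma>) w = v} = (if v = [snd (\<sigma> a)] then {[a]} else {})"
    by (auto simp: fa_var_def split: if_splits)
  then show "fa_subst \<sigma> (fa_var a) v = (fa_const (fst (\<sigma> a)) \<odot> fa_var (snd (\<sigma> a))) v"
    by (auto simp: fa_subst_def fa_var_def fa_const_mul)
qed

lemma fa_subst_mul [simp]: "fa_subst \<sigma> (p \<odot> q) = fa_subst \<sigma> p \<odot> fa_subst \<sigma> q"
proof
  fix v
  let ?f = "\<lambda>w. prod_list (map (fst \<circ> \<sigma>) w)" and ?m = "map (snd \<circ> \<sigma>)"
  have "fa_subst \<sigma> (p \<odot> q) v = (\<Sum>(a, b)\<in>{(a, b). ?m (a @ b) = v}. ?f (a @ b) * (p a * q b))"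
    unfolding fa_subst_apply using sum_fa_mul[OF finite_map_preimage, where f = ?f] by simp
  also have "\<dots> = (\<Sum>z\<in>(SIGMA x:{(c, d). c @ d = v}. {a. ?m a = fst x} \<times> {b. ?m b = snd x}).
      (?f (fst (snd z)) * p (fst (snd z))) * (?f (snd (snd z)) * q (snd (snd z))))"
    by (rule sum.reindex_bij_witness[of _ snd "\<lambda>(a, b). ((?m a, ?m b), (a, b))"]) auto
  also have "\<dots> = (\<Sum>x\<in>{(c, d). c @ d = v}. \<Sum>y\<in>{a. ?m a = fst x} \<times> {b. ?m b = snd x}.
      (?f (fst y) * p (fst y)) * (?f (snd y) * q (snd y)))"
    using finite_append_pairs finite_map_preimage
    by (subst sum.Sigma) (auto intro!: sum.cong finite_cartesian_product)
  also have "\<dots> = (fa_subst \<sigma> p \<odot> fa_subst \<sigma> q) v"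
    unfolding fa_mul_apply[of "fa_subst \<sigma> p"] fa_subst_apply sum_product
    by (intro sum.cong refl) (auto simp: sum.cartesian_product split_def)
  finally show "fa_subst \<sigma> (p \<odot> q) v = (fa_subst \<sigma> p \<odot> fa_subst \<sigma> q) v" .
qed

lemma fa_fin_subst [simp]:
  assumes "fa_fin p"
  shows "fa_fin (fa_subst \<sigma> p)"
proof -
  have "{v. fa_subst \<sigma> p v \<noteq> 0} \<subseteq> map (snd \<circ> \<sigma>) ` {w. p w \<noteq> 0}"
  proof
    fix v assume "v \<in> {v. fa_subst \<sigma> p v \<noteq> 0}"
    then have "{w. p w \<noteq> 0 \<and> map (snd \<circ> \<sigma>) w = v} \<noteq> {}"
      unfolding fa_subst_def by (metis (mono_tags, lifting) mem_Collect_eq sum.empty)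
    then show "v \<in> map (snd \<circ> \<sigma>) ` {w. p w \<noteq> 0}" by auto
  qed
  then show ?thesis using assms unfolding fa_fin_def by (blast intro: finite_subset)
qed

lemma fa_subst_ideal:
  assumes "\<And>r. r \<in> set B_rels \<Longrightarrow> cls (fa_subst \<sigma> r) = 0" "p \<in> B_ideal"
  shows "fa_subst \<sigma> p \<in> B_ideal"
  using assms(2)
proof (induction rule: B_ideal.induct)
  case (rel r)
  then have "fa_fin r" using fa_fin_ideal B_ideal.rel by blast
  then show ?case using assms(1)[OF rel] cls_eq_0_iff[of "fa_subst \<sigma> r"] by simp
qed (auto intro: B_ideal.intros)

text \<open>It suffices that the images of the fifteen relations sort to 0. Hence both substitutions
  descend to \<open>B\<close>.\<close>

lemma sigma_ideal: "p \<in> B_ideal \<Longrightarrow> fa_subst sigma_r p \<in> B_ideal" "p \<in> B_ideal \<Longrightarrow> fa_subst sigma_s p \<in> B_ideal"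
  by (rule fa_subst_ideal; auto simp: B_rels_def sort_simps)+

lift_definition ract :: "balg \<Rightarrow> balg" is "fa_subst sigma_r"
  using sigma_ideal by (auto simp: B_eq_def simp flip: fa_subst_diff)

lift_definition sact :: "balg \<Rightarrow> balg" is "fa_subst sigma_s"
  using sigma_ideal by (auto simp: B_eq_def simp flip: fa_subst_diff)

lemma ract_cls: "fa_fin p \<Longrightarrow> ract (cls p) = cls (fa_subst sigma_r p)"
  by (simp add: ract.abs_eq B_eq_refl)

lemma sact_cls: "fa_fin p \<Longrightarrow> sact (cls p) = cls (fa_subst sigma_s p)"
  by (simp add: sact.abs_eq B_eq_refl)

lemma ract_hom [simp]: "ract (a + b) = ract a + ract b" "ract (a - b) = ract a - ract b"
  "ract (a * b) = ract a * ract b" "ract (scal c) = scal c"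
  "ract (gn g) = scal (fst (sigma_r g)) * gn (snd (sigma_r g))"
proof -
  show "ract (a + b) = ract a + ract b" "ract (a - b) = ract a - ract b" "ract (a * b) = ract a * ract b"
    by (transfer; simp add: B_eq_refl)+
  show "ract (scal c) = scal c" "ract (gn g) = scal (fst (sigma_r g)) * gn (snd (sigma_r g))"
    using ract_cls[of "fa_const c"] ract_cls[of "fa_var g"] by simp_all
qed

lemma sact_hom [simp]: "sact (a + b) = sact a + sact b" "sact (a - b) = sact a - sact b"
  "sact (a * b) = sact a * sact b" "sact (scal c) = scal c"
  "sact (gn g) = scal (fst (sigma_s g)) * gn (snd (sigma_s g))"
proof -
  show "sact (a + b) = sact a + sact b" "sact (a - b) = sact a - sact b" "sact (a * b) = sact a * sact b"
    by (transfer; simp add: B_eq_refl)+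
  show "sact (scal c) = scal c" "sact (gn g) = scal (fst (sigma_s g)) * gn (snd (sigma_s g))"
    using sact_cls[of "fa_const c"] sact_cls[of "fa_var g"] by simp_all
qed

lemma act_hom_consequences [simp]: "ract 0 = 0" "ract 1 = 1" "sact 0 = 0" "sact 1 = 1"
   "ract (- a) = - ract a" "sact (- a) = - sact a"
  "ract (a ^ n) = ract a ^ n" "sact (a ^ n) = sact a ^ n"
proof -
  show z: "ract 0 = 0" "ract 1 = 1" "sact 0 = 0" "sact 1 = 1"
    using ract_hom(4)[of 0] ract_hom(4)[of 1] sact_hom(4)[of 0] sact_hom(4)[of 1] by simp_all
  show "ract (- a) = - ract a" "sact (- a) = - sact a"
    using ract_hom(2)[of 0 a] sact_hom(2)[of 0 a] z by simp_all
  show "ract (a ^ n) = ract a ^ n" "sact (a ^ n) = sact a ^ n"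
    by (induction n) (simp_all add: z)
qed

lemma cls_act:
  assumes "fa_fin p"
  shows "fa_fin (act p (k, j))" "cls (act p (k, j)) = (sact ^^ (if j then 1 else 0)) ((ract ^^ k) (cls p))"
proof -
  have "fa_fin ((fa_subst sigma_r ^^ k) p) \<and> cls ((fa_subst sigma_r ^^ k) p) = (ract ^^ k) (cls p)"
    using assms by (induction k) (auto simp flip: ract_cls)
  then show "fa_fin (act p (k, j))" "cls (act p (k, j)) = (sact ^^ (if j then 1 else 0)) ((ract ^^ k) (cls p))"
    by (auto simp: act_def simp flip: sact_cls)
qed

section \<open>Orbit sums in the commutative even part\<close>

text \<open>Orbit sums are reduced in a commutative ring, which \<open>B\<close> is not, so the
  setting is a subring \<open>A\<close> of an arbitrary one. The names \<open>X1\<close>, ...,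
  \<open>Z2\<close> are ring elements here and hide the constructors of \<open>gen\<close>. Of
  \<open>u\<close> only the square lies in \<open>A\<close>, since \<open>r\<close> negates
  \<open>x1 x2\<close>; the sign in \<open>Z12\<close> is there because \<open>z1\<close> and
  \<open>z2\<close> anticommute.\<close>

locale even_generators =
  fixes A :: "'a::comm_ring_1 set" and u v w X1 X2 Y1 Y2 Z1 Z2 :: 'a
  assumes one: "1 \<in> A"
    and add: "\<And>a b. a \<in> A \<Longrightarrow> b \<in> A \<Longrightarrow> a + b \<in> A"
    and mult: "\<And>a b. a \<in> A \<Longrightarrow> b \<in> A \<Longrightarrow> a * b \<in> A"
    and uminus: "\<And>a. a \<in> A \<Longrightarrow> - a \<in> A"
    and X12: "X1 * X2 = u\<^sup>2" and Y12: "Y1 * Y2 = v\<^sup>2" and Z12: "Z1 * Z2 = - w\<^sup>2"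
    and g1: "v \<in> A" and g2: "w \<in> A" and g3: "u\<^sup>2 \<in> A"
    and g4: "X1\<^sup>2 + X2\<^sup>2 \<in> A" and g5: "Y1\<^sup>2 + Y2\<^sup>2 \<in> A" and g6: "Z1\<^sup>2 + Z2\<^sup>2 \<in> A"
    and g7: "(X1 - X2) * (Y1 - Y2) \<in> A" and g8: "(X1 + X2) * (Z1 - Z2) \<in> A"
    and g9: "u * (X1\<^sup>2 - X2\<^sup>2) \<in> A"
    and g10: "u * (X1 + X2) * (Y1 - Y2) \<in> A" and g11: "u * (X1 - X2) * (Z1 - Z2) \<in> A"
    and g12: "u * (Y1 * Z1 + Y2 * Z2) \<in> A" and g13: "u * (Y1 * Z2 + Y2 * Z1) \<in> A"
    and g14: "(X1\<^sup>2 - X2\<^sup>2) * (Y1 * Z2 + Y2 * Z1) \<in> A"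
    and g15: "(X1 + X2) * (Y1\<^sup>2 * Z2 - Y2\<^sup>2 * Z1) \<in> A"
    and g16: "(X1 - X2) * (Y1 * Z2\<^sup>2 - Y2 * Z1\<^sup>2) \<in> A"
    and g17: "Y1\<^sup>2 * Z2\<^sup>2 + Y2\<^sup>2 * Z1\<^sup>2 \<in> A"
begin

lemma diff: "a \<in> A \<Longrightarrow> b \<in> A \<Longrightarrow> a - b \<in> A"
  using add[OF _ uminus, of a b] by simp

lemma zero: "0 \<in> A"
  using diff[OF one one] by simp

lemma power: "a \<in> A \<Longrightarrow> a ^ n \<in> A"
  by (induction n) (auto intro: one mult)

lemma squares: "u\<^sup>2 = X1 * X2" "v\<^sup>2 = Y1 * Y2" "w\<^sup>2 = - (Z1 * Z2)"
  using X12 Y12 Z12 by simp_all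

lemmas closed = one zero add diff mult uminus power g1 g2 g3 g4 g5 g6

text \<open>Powers of \<open>a\<close> and \<open>b\<close> obey the linear recurrence with coefficients \<open>a + b\<close> and \<open>- a b\<close>.\<close>
lemma two_power_combination:
  assumes "a + b \<in> A" "a * b \<in> A" "P + Q \<in> A" "a * P + b * Q \<in> A"
  shows "a ^ n * P + b ^ n * Q \<in> A"
proof (induction n rule: less_induct)
  case (less n)
  consider "n = 0" | "n = 1" | j where "n = Suc (Suc j)"
    by (metis One_nat_def not0_implies_Suc)
  then show ?case
  proof cases
    case 3
    have "a ^ n * P + b ^ n * Q =
        (a + b) * (a ^ Suc j * P + b ^ Suc j * Q) - (a * b) * (a ^ j * P + b ^ j * Q)"
      unfolding 3 by (simp add: algebra_simps)
    moreover have "a ^ Suc j * P + b ^ Suc j * Q \<in> A" "a ^ j * P + b ^ j * Q \<in> A"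
      using less[of "Suc j"] less[of j] 3 by auto
    ultimately show ?thesis
      using assms by (auto intro!: diff mult)
  qed (use assms in auto)
qed

lemma X_squares_mult: "X1\<^sup>2 * X2\<^sup>2 \<in> A"
  using power[OF g3, of 2] X12 by (metis power_mult_distrib)

lemma X_even_plus:
  assumes "W \<in> A"
  shows "(X1 ^ (2 * n) + X2 ^ (2 * n)) * W \<in> A"
proof -
  have "(X1\<^sup>2) ^ n * W + (X2\<^sup>2) ^ n * W \<in> A"
  proof (rule two_power_combination[OF g4 X_squares_mult])
    show "W + W \<in> A" using assms by (intro add)
    show "X1\<^sup>2 * W + X2\<^sup>2 * W \<in> A" using mult[OF g4 assms] by (simp add: distrib_right)
  qed
  then show ?thesis
    by (simp add: power_mult distrib_right)
qed

text \<open>The recurrence starts with 0, so its second member is the only input.\<close>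

lemma X_even_minus:
  assumes "(X1\<^sup>2 - X2\<^sup>2) * W \<in> A"
  shows "(X1 ^ (2 * n) - X2 ^ (2 * n)) * W \<in> A"
proof -
  have "(X1\<^sup>2) ^ n * W + (X2\<^sup>2) ^ n * (- W) \<in> A"
    using assms zero
    by (intro two_power_combination[OF g4 X_squares_mult]) (simp_all add: left_diff_distrib)
  then show ?thesis
    by (simp add: power_mult left_diff_distrib)
qed

text \<open>The second member of the recurrence factors as
  \<open>X1^3 + s X2^3 = (X1^2 + X2^2 - s X1 X2) (X1 + s X2)\<close>, because
  \<open>s^2 = 1\<close>, and \<open>X1 X2 = u^2\<close>.\<close>

lemma X_odd:
  assumes "(X1 + s * X2) * W \<in> A" "s = 1 \<or> s = -1"
  shows "(X1 ^ (2 * n + 1) + s * X2 ^ (2 * n + 1)) * W \<in> A"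
proof -
  have "s * u\<^sup>2 \<in> A"
    using assms(2) uminus[OF g3] g3 by auto
  then have "(X1\<^sup>2 + X2\<^sup>2 - s * u\<^sup>2) * ((X1 + s * X2) * W) \<in> A"
    by (intro mult[OF diff[OF g4] assms(1)])
  also have "(X1\<^sup>2 + X2\<^sup>2 - s * u\<^sup>2) * ((X1 + s * X2) * W) = X1\<^sup>2 * (X1 * W) + X2\<^sup>2 * (s * X2 * W)"
    using assms(2) unfolding squares by (auto simp: algebra_simps power2_eq_square)
  finally have "(X1\<^sup>2) ^ n * (X1 * W) + (X2\<^sup>2) ^ n * (s * X2 * W) \<in> A"
    using assms(1) by (intro two_power_combination[OF g4 X_squares_mult]) (simp_all add: distrib_right)
  then show ?thesis
    unfolding power_add power_mult by (simp add: algebra_simps)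
qed

lemma u_power_odd:
  assumes "u * W \<in> A" "odd i"
  shows "u ^ i * W \<in> A"
proof -
  obtain j where "i = 2 * j + 1" using \<open>odd i\<close> by (rule oddE)
  then have "u ^ i * W = (u\<^sup>2) ^ j * (u * W)"
    by (simp add: power_mult mult.left_commute mult.assoc)
  then show ?thesis
    using mult[OF power[OF g3] assms(1)] by simp
qed

lemma u_power_even:
  assumes "W \<in> A" "even i"
  shows "u ^ i * W \<in> A"
proof -
  obtain j where "i = 2 * j" using \<open>even i\<close> by (rule evenE)
  then show ?thesis
    using mult[OF power[OF g3] assms(1)] by (simp add: power_mult)
qed

text \<open>The recurrence runs in the exponent of \<open>Y\<close> with that of \<open>P\<close> at
  its two starting values, and then in the exponent of \<open>P\<close>; hence four base cases.
  \<open>P1\<close> and \<open>P2\<close> are the two \<open>Z\<close> in either order.\<close>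

lemma YZ_combination:
  assumes base: "\<And>k m. k \<in> {\<kappa>, \<kappa> + 2} \<Longrightarrow> m \<in> {\<mu>, \<mu> + 2} \<Longrightarrow> \<xi> * (Y1 ^ k * P1 ^ m + s * Y2 ^ k * P2 ^ m) \<in> A"
    and P: "P1\<^sup>2 + P2\<^sup>2 \<in> A" "P1 * P2 = - w\<^sup>2"
  shows "\<xi> * (Y1 ^ (\<kappa> + 2 * k) * P1 ^ (\<mu> + 2 * m) + s * Y2 ^ (\<kappa> + 2 * k) * P2 ^ (\<mu> + 2 * m)) \<in> A"
proof -
  have YY: "Y1\<^sup>2 * Y2\<^sup>2 = (v\<^sup>2)\<^sup>2" by (metis Y12 power_mult_distrib)
  have "P1\<^sup>2 * P2\<^sup>2 = (- (w\<^sup>2))\<^sup>2" by (metis P(2) power_mult_distrib)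
  then have PP: "P1\<^sup>2 * P2\<^sup>2 = (w\<^sup>2)\<^sup>2" by simp
  have step: "\<xi> * (Y1 ^ (\<kappa> + 2 * k) * P1 ^ m + s * Y2 ^ (\<kappa> + 2 * k) * P2 ^ m) \<in> A"
    if "m \<in> {\<mu>, \<mu> + 2}" for m k
  proof -
    have "(Y1\<^sup>2) ^ k * (\<xi> * Y1 ^ \<kappa> * P1 ^ m) + (Y2\<^sup>2) ^ k * (\<xi> * s * Y2 ^ \<kappa> * P2 ^ m) \<in> A"
    proof (rule two_power_combination)
      show "Y1\<^sup>2 * Y2\<^sup>2 \<in> A" unfolding YY by (intro closed)
      show "\<xi> * Y1 ^ \<kappa> * P1 ^ m + \<xi> * s * Y2 ^ \<kappa> * P2 ^ m \<in> A"
        using base[OF _ that, of \<kappa>] by (simp add: algebra_simps)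
      show "Y1\<^sup>2 * (\<xi> * Y1 ^ \<kappa> * P1 ^ m) + Y2\<^sup>2 * (\<xi> * s * Y2 ^ \<kappa> * P2 ^ m) \<in> A"
        using base[OF _ that, of "\<kappa> + 2"] unfolding power_add by (simp add: algebra_simps)
    qed (rule g5)
    then show ?thesis unfolding power_add power_mult by (simp add: algebra_simps)
  qed
  have "(P1\<^sup>2) ^ m * (\<xi> * Y1 ^ (\<kappa> + 2 * k) * P1 ^ \<mu>) + (P2\<^sup>2) ^ m * (\<xi> * s * Y2 ^ (\<kappa> + 2 * k) * P2 ^ \<mu>) \<in> A"
  proof (rule two_power_combination)
    show "P1\<^sup>2 * P2\<^sup>2 \<in> A" unfolding PP by (intro closed)
    show "\<xi> * Y1 ^ (\<kappa> + 2 * k) * P1 ^ \<mu> + \<xi> * s * Y2 ^ (\<kappa> + 2 * k) * P2 ^ \<mu> \<in> A"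
      using step[of \<mu> k] by (simp add: algebra_simps)
    show "P1\<^sup>2 * (\<xi> * Y1 ^ (\<kappa> + 2 * k) * P1 ^ \<mu>) + P2\<^sup>2 * (\<xi> * s * Y2 ^ (\<kappa> + 2 * k) * P2 ^ \<mu>) \<in> A"
      using step[of "\<mu> + 2" k] unfolding power_add by (simp add: algebra_simps)
  qed (rule P(1))
  then show ?thesis unfolding power_add power_mult by (simp add: algebra_simps)
qed

text \<open>Raising an exponent from 1 to 3 brings in the sum with \<open>Z1\<close> and
  \<open>Z2\<close> exchanged, so the two pairings of \<open>Y\<close> with \<open>Z\<close> are
  carried together. The factor \<open>\<xi>\<close> will be the part in \<open>u\<close> and
  \<open>X\<close>.\<close>

definition YZ_both :: "'a \<Rightarrow> 'a \<Rightarrow> nat \<Rightarrow> nat \<Rightarrow> bool" where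
  "YZ_both \<xi> s k m \<longleftrightarrow> \<xi> * (Y1 ^ k * Z1 ^ m + s * Y2 ^ k * Z2 ^ m) \<in> A \<and>
                      \<xi> * (Y1 ^ k * Z2 ^ m + s * Y2 ^ k * Z1 ^ m) \<in> A"

lemma YZ_both_mono:
  assumes "YZ_both \<xi> s k m" "\<And>W. \<xi> * W \<in> A \<Longrightarrow> \<eta> * W \<in> A"
  shows "YZ_both \<eta> s k m"
  using assms unfolding YZ_both_def by blast

lemma YZ_both_reduce:
  assumes "\<And>k m. k \<in> {\<kappa>, \<kappa> + 2} \<Longrightarrow> m \<in> {\<mu>, \<mu> + 2} \<Longrightarrow> YZ_both \<xi> s k m"
  shows "YZ_both \<xi> s (\<kappa> + 2 * k) (\<mu> + 2 * m)"
  unfolding YZ_both_def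
proof (intro conjI YZ_combination)
  show "Z2\<^sup>2 + Z1\<^sup>2 \<in> A" "Z2 * Z1 = - w\<^sup>2"
    using g6 Z12 by (simp_all add: add.commute mult.commute)
qed (use assms g6 Z12 in \<open>auto simp: YZ_both_def\<close>)

lemma YZ_both_Y3:
  assumes "YZ_both \<xi> s 1 m" "s = 1 \<or> s = -1"
  shows "YZ_both \<xi> s 3 m"
proof -
  have "\<xi> * (Y1 ^ 3 * P + s * Y2 ^ 3 * Q) = (Y1\<^sup>2 + Y2\<^sup>2) * (\<xi> * (Y1 ^ 1 * P + s * Y2 ^ 1 * Q))
      - s * v\<^sup>2 * (\<xi> * (Y1 ^ 1 * Q + s * Y2 ^ 1 * P))" for P Q
    using assms(2) unfolding squares by (auto simp: algebra_simps power2_eq_square power3_eq_cube)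
  moreover have "s * v\<^sup>2 \<in> A"
    using assms(2) by (auto intro!: closed)
  ultimately show ?thesis
    using assms(1) unfolding YZ_both_def by (auto intro!: diff mult[OF g5] mult[of "s * v\<^sup>2"])
qed

lemma YZ_both_Z3:
  assumes "YZ_both \<xi> s k 1"
  shows "YZ_both \<xi> s k 3"
proof -
  have "\<xi> * (P * Z1 ^ 3 + s * Q * Z2 ^ 3) = (Z1\<^sup>2 + Z2\<^sup>2) * (\<xi> * (P * Z1 ^ 1 + s * Q * Z2 ^ 1))
      + w\<^sup>2 * (\<xi> * (P * Z2 ^ 1 + s * Q * Z1 ^ 1))"
    "\<xi> * (P * Z2 ^ 3 + s * Q * Z1 ^ 3) = (Z1\<^sup>2 + Z2\<^sup>2) * (\<xi> * (P * Z2 ^ 1 + s * Q * Z1 ^ 1))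
      + w\<^sup>2 * (\<xi> * (P * Z1 ^ 1 + s * Q * Z2 ^ 1))" for P Q
    unfolding squares by (simp_all add: algebra_simps power2_eq_square power3_eq_cube)
  moreover have "w\<^sup>2 \<in> A" by (intro closed)
  ultimately show ?thesis
    using assms unfolding YZ_both_def by (auto intro!: add mult[OF g6] mult[of "w\<^sup>2"])
qed

text \<open>For exponents 2 and 2 one pairing is \<open>g17\<close>, and the other is what remains
  of \<open>g5 g6\<close>.\<close>

lemma YZ_both_even_even:
  assumes "even k" "even m" "\<xi> \<in> A"
  shows "YZ_both \<xi> 1 k m"
proof -
  have "Y1\<^sup>2 * Z1\<^sup>2 + Y2\<^sup>2 * Z2\<^sup>2 = (Y1\<^sup>2 + Y2\<^sup>2) * (Z1\<^sup>2 + Z2\<^sup>2) - (Y1\<^sup>2 * Z2\<^sup>2 + Y2\<^sup>2 * Z1\<^sup>2)"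
    by (simp add: algebra_simps)
  then have "Y1\<^sup>2 * Z1\<^sup>2 + Y2\<^sup>2 * Z2\<^sup>2 \<in> A" by (auto intro!: diff mult g5 g6 g17)
  moreover have "Z2\<^sup>2 + Z1\<^sup>2 \<in> A" using g6 by (simp add: add.commute)
  moreover have "1 + 1 \<in> A" by (intro closed)
  ultimately have "YZ_both \<xi> 1 (0 + 2 * k) (0 + 2 * m)" for k m
    using g5 g6 g17
    by (intro YZ_both_reduce) (auto simp: YZ_both_def power2_eq_square intro!: mult[OF assms(3)])
  then show ?thesis using assms by (auto elim!: evenE)
qed

lemma YZ_both_odd_odd:
  assumes "odd k" "odd m" "YZ_both \<xi> 1 1 1"
  shows "YZ_both \<xi> 1 k m"
proof -
  have "YZ_both \<xi> 1 (1 + 2 * k) (1 + 2 * m)" for k m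
    using assms(3) YZ_both_Y3 YZ_both_Z3
    by (intro YZ_both_reduce) (auto simp: numeral_3_eq_3 numeral_2_eq_2)
  from this[of "k div 2" "m div 2"] show ?thesis using assms by simp
qed

lemma YZ_both_odd_even:
  assumes "odd k" "even m" "\<xi> * (Y1 - Y2) \<in> A" "\<xi> * (Y1 * Z2\<^sup>2 - Y2 * Z1\<^sup>2) \<in> A"
  shows "YZ_both \<xi> (-1) k m"
proof -
  have "\<xi> * (Y1 * Z1\<^sup>2 - Y2 * Z2\<^sup>2) = (Z1\<^sup>2 + Z2\<^sup>2) * (\<xi> * (Y1 - Y2)) - \<xi> * (Y1 * Z2\<^sup>2 - Y2 * Z1\<^sup>2)"
    by (simp add: algebra_simps)
  then have "\<xi> * (Y1 * Z1\<^sup>2 - Y2 * Z2\<^sup>2) \<in> A" using assms by (auto intro!: diff mult[OF g6])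
  then have "YZ_both \<xi> (-1) 1 0" "YZ_both \<xi> (-1) 1 2"
    using assms by (auto simp: YZ_both_def)
  moreover from this have "YZ_both \<xi> (-1) 3 0" "YZ_both \<xi> (-1) 3 2"
    using YZ_both_Y3 by auto
  ultimately have "YZ_both \<xi> (-1) (1 + 2 * k) (0 + 2 * m)" for k m
    by (intro YZ_both_reduce) (auto simp: numeral_3_eq_3 numeral_2_eq_2)
  from this[of "k div 2" "m div 2"] show ?thesis using assms by simp
qed

lemma YZ_both_even_odd:
  assumes "even k" "odd m" "\<xi> * (Z1 - Z2) \<in> A" "\<xi> * (Y1\<^sup>2 * Z2 - Y2\<^sup>2 * Z1) \<in> A"
  shows "YZ_both \<xi> (-1) k m"
proof -
  have "\<xi> * (Y1\<^sup>2 * Z1 - Y2\<^sup>2 * Z2) = (Y1\<^sup>2 + Y2\<^sup>2) * (\<xi> * (Z1 - Z2)) + \<xi> * (Y1\<^sup>2 * Z2 - Y2\<^sup>2 * Z1)"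
    by (simp add: algebra_simps)
  then have "\<xi> * (Y1\<^sup>2 * Z1 - Y2\<^sup>2 * Z2) \<in> A" using assms by (auto intro!: add mult[OF g5])
  moreover have "\<xi> * (Z2 - Z1) \<in> A" using uminus[OF assms(3)] by (simp add: algebra_simps)
  ultimately have "YZ_both \<xi> (-1) 0 1" "YZ_both \<xi> (-1) 2 1"
    using assms by (auto simp: YZ_both_def)
  moreover from this have "YZ_both \<xi> (-1) 0 3" "YZ_both \<xi> (-1) 2 3"
    using YZ_both_Z3 by auto
  ultimately have "YZ_both \<xi> (-1) (0 + 2 * k) (1 + 2 * m)" for k m
    by (intro YZ_both_reduce) (auto simp: numeral_3_eq_3 numeral_2_eq_2)
  from this[of "k div 2" "m div 2"] show ?thesis using assms by simp
qed

text \<open>The four pairs of parities of \<open>n\<close> and \<open>m\<close> are the four isotypic pieces; for each one the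
  \<open>X\<close>-part is generated over \<open>u\<^sup>2\<close> and \<open>X1\<^sup>2 + X2\<^sup>2\<close> by one element without and one with a factor \<open>u\<close>.\<close>
lemma orbit_sum_mem:
  assumes "even (n + k + m)"
  shows "YZ_both (u ^ i * (X1 ^ n + (-1) ^ (i + m + n) * X2 ^ n)) ((-1) ^ n) k m"
proof -
  have Xeven: "YZ_both (u ^ i * (X1 ^ n + (-1) ^ (i + m + n) * X2 ^ n)) t k m"
    if "even n" and plus: "even (i + m) \<Longrightarrow> YZ_both (u ^ i) t k m"
      and minus: "odd (i + m) \<Longrightarrow> YZ_both (u ^ i * (X1\<^sup>2 - X2\<^sup>2)) t k m" for t
  proof (cases "even (i + m)")
    case True
    from \<open>even n\<close> obtain j where "n = 2 * j" by blast
    then show ?thesis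
      using X_even_plus[where n = j, of "u ^ i * W" for W] True
      by (intro YZ_both_mono[OF plus[OF True]]) (simp add: mult.assoc mult.left_commute[of "u ^ i"])
  next
    case False
    from \<open>even n\<close> obtain j where "n = 2 * j" by blast
    then show ?thesis
      using X_even_minus[where n = j, of "u ^ i * W" for W] False
      by (intro YZ_both_mono[OF minus[OF False]]) (simp add: mult.assoc mult.left_commute[of "u ^ i"])
  qed
  have Xodd: "YZ_both (u ^ i * (X1 ^ n + (-1) ^ (i + m + n) * X2 ^ n)) t k m"
    if "odd n" "YZ_both (u ^ i * (X1 + (-1) ^ (i + m + 1) * X2)) t k m" for t
  proof -
    from \<open>odd n\<close> obtain j where j: "n = 2 * j + 1" by (rule oddE)
    define s :: 'a where "s = (-1) ^ (i + m + 1)"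
    have s: "s = 1 \<or> s = -1"
      by (simp add: minus_one_power_iff s_def)
    have e: "(-1::'a) ^ (i + m + n) = s"
      by (simp add: j s_def power_add power_mult)
    show ?thesis
      unfolding e unfolding j
      using X_odd[OF _ s, where n = j, of "u ^ i * W" for W]
      by (intro YZ_both_mono[OF that(2)]) (simp only: mult.assoc mult.left_commute[of "u ^ i"] s_def)
  qed
  have u_shift: "YZ_both (u ^ i * \<eta>) t k m"
    if "odd i \<Longrightarrow> YZ_both (u * \<eta>) t k m" "even i \<Longrightarrow> YZ_both \<eta> t k m" for \<eta> t
    using that u_power_odd[where i=i] u_power_even[where i=i] unfolding YZ_both_def mult.assoc by (cases "even i") simp_all
  consider "even n" "even k" "even m" | "even n" "odd k" "odd m" | "odd n" "odd k" "even m" | "odd n" "even k" "odd m"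
    using assms by auto
  then show ?thesis
  proof cases
    case 1
    have "YZ_both (u ^ i) 1 k m" if "even (i + m)"
      using u_shift[of 1] YZ_both_even_even[OF 1(2,3) one] that 1 by auto
    moreover have "YZ_both (u ^ i * (X1\<^sup>2 - X2\<^sup>2)) 1 k m" if "odd (i + m)"
      using u_shift[of "X1\<^sup>2 - X2\<^sup>2"] YZ_both_even_even[OF 1(2,3) g9] that 1 by auto
    ultimately show ?thesis using Xeven 1 by simp
  next
    case 2
    have "YZ_both u 1 1 1" using g12 g13 by (simp add: YZ_both_def)
    then have "YZ_both (u ^ i) 1 k m" if "even (i + m)"
      using u_shift[of 1] YZ_both_odd_odd[OF 2(2,3)] that 2 by auto
    \<comment> \<open>Only one pairing is a generator, \<open>g14\<close>; the other differs from it
      by \<open>g7 g8\<close>.\<close>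
    moreover have "(X1\<^sup>2 - X2\<^sup>2) * (Y1 * Z1 + Y2 * Z2) = (X1 - X2) * (Y1 - Y2) * ((X1 + X2) * (Z1 - Z2))
         + (X1\<^sup>2 - X2\<^sup>2) * (Y1 * Z2 + Y2 * Z1)"
      by (simp add: algebra_simps power2_eq_square)
    then have "YZ_both (X1\<^sup>2 - X2\<^sup>2) 1 1 1" by (auto simp: YZ_both_def intro!: add mult[OF g7 g8] g14)
    then have "YZ_both (u ^ i * (X1\<^sup>2 - X2\<^sup>2)) 1 k m" if "odd (i + m)"
      using u_shift[of "X1\<^sup>2 - X2\<^sup>2"] YZ_both_odd_odd[OF 2(2,3)] that 2 by auto
    ultimately show ?thesis using Xeven 2 by simp
  next
    case 3
    \<comment> \<open>With the factor \<open>u\<close> the analogue of \<open>g16\<close> is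
      decomposable: it equals \<open>- g8 g13 - w^2 g10\<close>.\<close>
    have "u * (X1 + X2) * (Y1 * Z2\<^sup>2 - Y2 * Z1\<^sup>2) =
        - ((X1 + X2) * (Z1 - Z2) * (u * (Y1 * Z2 + Y2 * Z1))) - w\<^sup>2 * (u * (X1 + X2) * (Y1 - Y2))"
      unfolding squares by (simp add: algebra_simps power2_eq_square)
    then have "u * (X1 + X2) * (Y1 * Z2\<^sup>2 - Y2 * Z1\<^sup>2) \<in> A"
      by (auto intro!: diff uminus mult[OF g8 g13] mult[of "w\<^sup>2"] power g2 g10)
    then have "YZ_both (u * (X1 + X2)) (-1) k m" "YZ_both (X1 - X2) (-1) k m"
      using YZ_both_odd_even[OF 3(2,3)] g7 g16 g10 by auto
    then have "YZ_both (u ^ i * (X1 + (-1) ^ (i + m + 1) * X2)) (-1) k m"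
      using u_shift 3 by (cases "even i") auto
    then show ?thesis using Xodd 3 by simp
  next
    case 4
    \<comment> \<open>Likewise the analogue of \<open>g15\<close> is
      \<open>g7 g13 - v^2 g11\<close>.\<close>
    have "u * (X1 - X2) * (Y1\<^sup>2 * Z2 - Y2\<^sup>2 * Z1) =
        (X1 - X2) * (Y1 - Y2) * (u * (Y1 * Z2 + Y2 * Z1)) - v\<^sup>2 * (u * (X1 - X2) * (Z1 - Z2))"
      unfolding squares by (simp add: algebra_simps power2_eq_square)
    then have "u * (X1 - X2) * (Y1\<^sup>2 * Z2 - Y2\<^sup>2 * Z1) \<in> A"
      by (auto intro!: diff mult[OF g7 g13] mult[of "v\<^sup>2"] power g1 g11)
    then have "YZ_both (u * (X1 - X2)) (-1) k m" "YZ_both (X1 + X2) (-1) k m"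
      using YZ_both_even_odd[OF 4(2,3)] g8 g15 g11 by auto
    then have "YZ_both (u ^ i * (X1 + (-1) ^ (i + m + 1) * X2)) (-1) k m"
      using u_shift 4 by (cases "even i") auto
    then show ?thesis using Xodd 4 by simp
  qed
qed

end

section \<open>The even part of the quotient algebra\<close>

abbreviation bu :: balg where "bu \<equiv> gn X1 * gn X2"
abbreviation bv :: balg where "bv \<equiv> gn Y1 * gn Y2"
abbreviation bw :: balg where "bw \<equiv> gn Z1 * gn Z2"

text \<open>A monomial of even degree in each pair of variables is, up to a scalar, a product of
  these nine elements.\<close>

definition even_gens :: "balg set" where
  "even_gens = {bu, bv, bw, (gn X1)\<^sup>2, (gn X2)\<^sup>2, (gn Y1)\<^sup>2, (gn Y2)\<^sup>2, (gn Z1)\<^sup>2, (gn Z2)\<^sup>2}"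

inductive_set evens :: "balg set" where
  scal: "scal c \<in> evens"
| gen: "g \<in> even_gens \<Longrightarrow> g \<in> evens"
| add: "a \<in> evens \<Longrightarrow> b \<in> evens \<Longrightarrow> a + b \<in> evens"
| mult: "a \<in> evens \<Longrightarrow> b \<in> evens \<Longrightarrow> a * b \<in> evens"

lemma even_gens_commute: "a \<in> even_gens \<Longrightarrow> b \<in> even_gens \<Longrightarrow> a * b = b * a"
  unfolding even_gens_def by (auto simp: power2_eq_square sort_simps)

text \<open>Commuting with a fixed element passes from generators to all that they generate; this is
  used once for each factor.\<close>

lemma evens_commute:
  assumes "a \<in> evens" "b \<in> evens"
  shows "a * b = b * a"
proof -
  have step: "c * b = b * c" if "\<And>g. g \<in> even_gens \<Longrightarrow> c * g = g * c" "b \<in> evens" for b c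
    using that(2)
  proof (induction rule: evens.induct)
    case (mult x y)
    then show ?case by (metis mult.assoc)
  qed (auto simp: that(1) algebra_simps scal_commute)
  have "a * g = g * a" if "g \<in> even_gens" for g
    using step[OF even_gens_commute[OF that] assms(1)] by simp
  from step[OF this assms(2)] show ?thesis .
qed

lemma evens_uminus: "a \<in> evens \<Longrightarrow> - a \<in> evens"
  using evens.mult[OF evens.scal[of "-1"], of a] by simp

text \<open>A type of its own makes the even part an instance of \<open>comm_ring_1\<close>, as the
  locale demands of its ambient ring.\<close>

typedef evn = evens
  using evens.scal by blast

setup_lifting type_definition_evn

instantiation evn :: comm_ring_1
begin

lift_definition zero_evn :: evn is 0 using evens.scal[of 0] by simp
lift_definition one_evn :: evn is 1 using evens.scal[of 1] by simp
lift_definition plus_evn :: "evn \<Rightarrow> evn \<Rightarrow> evn" is "(+)" by (rule evens.add)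
lift_definition uminus_evn :: "evn \<Rightarrow> evn" is uminus by (rule evens_uminus)
lift_definition minus_evn :: "evn \<Rightarrow> evn \<Rightarrow> evn" is "(-)"
  using evens.add[OF _ evens_uminus] by fastforce
lift_definition times_evn :: "evn \<Rightarrow> evn \<Rightarrow> evn" is "(*)" by (rule evens.mult)

instance
  by standard (transfer; simp add: algebra_simps evens_commute)+

end

lemma Rep_evn_hom [simp]: "Rep_evn 0 = 0" "Rep_evn 1 = 1" "Rep_evn (a + b) = Rep_evn a + Rep_evn b"
  "Rep_evn (- a) = - Rep_evn a" "Rep_evn (a - b) = Rep_evn a - Rep_evn b" "Rep_evn (a * b) = Rep_evn a * Rep_evn b"
  by (transfer; simp)+

lemma Rep_evn_power [simp]: "Rep_evn (a ^ n) = Rep_evn a ^ n"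
  by (induction n) simp_all

lift_definition eu :: evn is bu by (simp add: evens.gen even_gens_def)
lift_definition ev :: evn is bv by (simp add: evens.gen even_gens_def)
lift_definition ew :: evn is bw by (simp add: evens.gen even_gens_def)
lift_definition sq :: "gen \<Rightarrow> evn" is "\<lambda>a. (gn a)\<^sup>2"
  by (rename_tac a, case_tac a) (simp_all add: evens.gen even_gens_def)
lift_definition escal :: "complex \<Rightarrow> evn" is scal by (rule evens.scal)

lemmas Rep_evn_gens [simp] = eu.rep_eq ev.rep_eq ew.rep_eq sq.rep_eq escal.rep_eq

lemma acts_even_gens: "g \<in> even_gens \<Longrightarrow> ract g \<in> evens \<and> sact g \<in> evens"
proof -
  have *: "\<forall>g\<in>even_gens. g \<in> evens \<and> - g \<in> evens"
    by (simp add: evens.gen evens_uminus)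
  show "g \<in> even_gens \<Longrightarrow> ract g \<in> evens \<and> sact g \<in> evens"
    using *[unfolded even_gens_def power2_eq_square]
    unfolding even_gens_def power2_eq_square by (elim insertE emptyE) (simp_all add: sort_simps)
qed

lift_definition eract :: "evn \<Rightarrow> evn" is ract
proof -
  show "ract b \<in> evens" if "b \<in> evens" for b
    using that by (induction rule: evens.induct) (auto intro: evens.intros simp: acts_even_gens)
qed

lift_definition esact :: "evn \<Rightarrow> evn" is sact
proof -
  show "sact b \<in> evens" if "b \<in> evens" for b
    using that by (induction rule: evens.induct) (auto intro: evens.intros simp: acts_even_gens)
qed

lemma eacts_hom [simp]: "eract (a * b) = eract a * eract b" "eract (a ^ n) = eract a ^ n"
  "esact (a * b) = esact a * esact b" "esact (a ^ n) = esact a ^ n"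
  "eract (- a) = - eract a" "esact (- a) = - esact a" "eract 1 = 1" "esact 1 = 1"
proof -
  show *: "eract (a * b) = eract a * eract b" "esact (a * b) = esact a * esact b" "eract 1 = 1" "esact 1 = 1"
    "eract (- a) = - eract a" "esact (- a) = - esact a" for a b
    by (transfer; simp)+
  show "eract (a ^ n) = eract a ^ n" "esact (a ^ n) = esact a ^ n"
    by (induction n) (simp_all add: *)
qed

lemma eacts_gens [simp]: "eract eu = - eu" "eract ev = ev" "eract ew = ew"
  "esact eu = eu" "esact ev = ev" "esact ew = ew"
  "eract (sq X1) = sq X2" "eract (sq X2) = sq X1" "esact (sq X1) = - sq X1" "esact (sq X2) = - sq X2"
  "eract (sq Y1) = sq Y2" "eract (sq Y2) = sq Y1" "esact (sq Y1) = sq Y2" "esact (sq Y2) = sq Y1"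
  "eract (sq Z1) = - sq Z2" "eract (sq Z2) = - sq Z1" "esact (sq Z1) = sq Z2" "esact (sq Z2) = sq Z1"
  by (transfer; simp add: power2_eq_square sort_simps)+

section \<open>The subalgebra generated by the seventeen elements\<close>

lemma fa_fin_gB [simp]: "fa_fin (gB n)"
  by (simp add: gB_def)

lemma fa_alg_fin: "q \<in> fa_alg (gB ` S) \<Longrightarrow> fa_fin q"
  by (induction rule: fa_alg.induct) auto

definition inv_alg :: "balg set" where "inv_alg = cls ` fa_alg (gB ` {1..17})"

lemma inv_alg_scal: "scal c \<in> inv_alg"
  unfolding inv_alg_def using fa_alg.const[of c] by (metis cls_simps(1) imageI)

lemma inv_alg_gen: "n \<in> {1..17} \<Longrightarrow> cls (gB n) \<in> inv_alg"
  unfolding inv_alg_def by (intro imageI fa_alg.gen)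

lemma inv_alg_add: "a \<in> inv_alg \<Longrightarrow> b \<in> inv_alg \<Longrightarrow> a + b \<in> inv_alg"
  unfolding inv_alg_def
  by clarify (metis cls_add fa_alg.add fa_alg_fin imageI)

lemma inv_alg_mult: "a \<in> inv_alg \<Longrightarrow> b \<in> inv_alg \<Longrightarrow> a * b \<in> inv_alg"
  unfolding inv_alg_def
  by clarify (metis cls_mul fa_alg.mul fa_alg_fin imageI)

lemma inv_alg_uminus: "a \<in> inv_alg \<Longrightarrow> - a \<in> inv_alg"
  using inv_alg_mult[OF inv_alg_scal[of "-1"], of a] by simp

text \<open>Each generator is the image of the corresponding expression in \<open>u\<close>,
  \<open>v\<close>, \<open>w\<close> and the squares. Sorting is needed only where the square of a
  product of two variables is compared with a product of squares.\<close>

interpretation inv_alg: even_generators "{e. Rep_evn e \<in> inv_alg}" eu ev ew "sq X1" "sq X2" "sq Y1" "sq Y2" "sq Z1" "sq Z2"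
proof
  note [simp] = gB_def power2_eq_square power4_eq_xxxx mult.assoc
  show "ev \<in> {e. Rep_evn e \<in> inv_alg}" using inv_alg_gen[of 1] by simp
  show "ew \<in> {e. Rep_evn e \<in> inv_alg}" using inv_alg_gen[of 2] by simp
  show "eu\<^sup>2 \<in> {e. Rep_evn e \<in> inv_alg}" using inv_alg_gen[of 3] by (simp add: sort_simps)
  show "(sq X1)\<^sup>2 + (sq X2)\<^sup>2 \<in> {e. Rep_evn e \<in> inv_alg}" using inv_alg_gen[of 4] by simp
  show "(sq Y1)\<^sup>2 + (sq Y2)\<^sup>2 \<in> {e. Rep_evn e \<in> inv_alg}" using inv_alg_gen[of 5] by simp
  show "(sq Z1)\<^sup>2 + (sq Z2)\<^sup>2 \<in> {e. Rep_evn e \<in> inv_alg}" using inv_alg_gen[of 6] by simp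
  show "(sq X1 - sq X2) * (sq Y1 - sq Y2) \<in> {e. Rep_evn e \<in> inv_alg}" using inv_alg_gen[of 7] by simp
  show "(sq X1 + sq X2) * (sq Z1 - sq Z2) \<in> {e. Rep_evn e \<in> inv_alg}" using inv_alg_gen[of 8] by simp
  show "eu * ((sq X1)\<^sup>2 - (sq X2)\<^sup>2) \<in> {e. Rep_evn e \<in> inv_alg}" using inv_alg_gen[of 9] by simp
  show "eu * (sq X1 + sq X2) * (sq Y1 - sq Y2) \<in> {e. Rep_evn e \<in> inv_alg}" using inv_alg_gen[of 10] by simp
  show "eu * (sq X1 - sq X2) * (sq Z1 - sq Z2) \<in> {e. Rep_evn e \<in> inv_alg}" using inv_alg_gen[of 11] by simp
  show "eu * (sq Y1 * sq Z1 + sq Y2 * sq Z2) \<in> {e. Rep_evn e \<in> inv_alg}" using inv_alg_gen[of 12] by simp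
  show "eu * (sq Y1 * sq Z2 + sq Y2 * sq Z1) \<in> {e. Rep_evn e \<in> inv_alg}" using inv_alg_gen[of 13] by simp
  show "((sq X1)\<^sup>2 - (sq X2)\<^sup>2) * (sq Y1 * sq Z2 + sq Y2 * sq Z1) \<in> {e. Rep_evn e \<in> inv_alg}" using inv_alg_gen[of 14] by simp
  show "(sq X1 + sq X2) * ((sq Y1)\<^sup>2 * sq Z2 - (sq Y2)\<^sup>2 * sq Z1) \<in> {e. Rep_evn e \<in> inv_alg}" using inv_alg_gen[of 15] by simp
  show "(sq X1 - sq X2) * (sq Y1 * (sq Z2)\<^sup>2 - sq Y2 * (sq Z1)\<^sup>2) \<in> {e. Rep_evn e \<in> inv_alg}" using inv_alg_gen[of 16] by simp
  show "(sq Y1)\<^sup>2 * (sq Z2)\<^sup>2 + (sq Y2)\<^sup>2 * (sq Z1)\<^sup>2 \<in> {e. Rep_evn e \<in> inv_alg}" using inv_alg_gen[of 17] by simp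
  show "sq X1 * sq X2 = eu\<^sup>2" "sq Y1 * sq Y2 = ev\<^sup>2" "sq Z1 * sq Z2 = - ew\<^sup>2"
    unfolding Rep_evn_inject[symmetric] by (simp_all add: sort_simps)
qed (use inv_alg_scal[of 1] inv_alg_add inv_alg_mult inv_alg_uminus in auto)

section \<open>Sorted monomials and averaging\<close>

definition mon :: "nat \<Rightarrow> nat \<Rightarrow> nat \<Rightarrow> nat \<Rightarrow> nat \<Rightarrow> nat \<Rightarrow> balg" where
  "mon a b c d e f = gn X1 ^ a * (gn X2 ^ b * (gn Y1 ^ c * (gn Y2 ^ d * (gn Z1 ^ e * gn Z2 ^ f))))"

lemma power_move:
  assumes "g * x = scal t * (y * g)"
  shows "g * (x ^ n * b) = scal (t ^ n) * (y ^ n * (g * b))"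
proof (induction n)
  case (Suc n)
  have "g * (x ^ Suc n * b) = (g * x) * (x ^ n * b)"
    by (simp add: mult.assoc)
  also have "\<dots> = scal t * (y * (g * (x ^ n * b)))"
    unfolding assms by (simp add: mult.assoc)
  also have "\<dots> = scal t * ((y * scal (t ^ n)) * (y ^ n * (g * b)))"
    unfolding Suc by (simp add: mult.assoc)
  also have "\<dots> = scal (t ^ Suc n) * (y ^ Suc n * (g * b))"
    unfolding scal_commute by (simp add: mult.assoc)
  finally show ?case .
qed simp

lemma gn_power_move:
  "gn X2 * (gn X1 ^ n * b) = gn X1 ^ n * (gn X2 * b)"
  "gn Y1 * (gn X1 ^ n * b) = gn X2 ^ n * (gn Y1 * b)" "gn Y1 * (gn X2 ^ n * b) = gn X1 ^ n * (gn Y1 * b)"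
  "gn Y2 * (gn X1 ^ n * b) = scal ((-1) ^ n) * (gn X2 ^ n * (gn Y2 * b))"
  "gn Y2 * (gn X2 ^ n * b) = scal ((-1) ^ n) * (gn X1 ^ n * (gn Y2 * b))"
  "gn Y2 * (gn Y1 ^ n * b) = gn Y1 ^ n * (gn Y2 * b)"
  "gn Z1 * (gn X1 ^ n * b) = scal ((-\<i>) ^ n) * (gn X2 ^ n * (gn Z1 * b))"
  "gn Z1 * (gn X2 ^ n * b) = scal ((-\<i>) ^ n) * (gn X1 ^ n * (gn Z1 * b))"
  "gn Z1 * (gn Y1 ^ n * b) = gn Y1 ^ n * (gn Z1 * b)" "gn Z1 * (gn Y2 ^ n * b) = gn Y2 ^ n * (gn Z1 * b)"
  "gn Z2 * (gn X1 ^ n * b) = scal (\<i> ^ n) * (gn X2 ^ n * (gn Z2 * b))"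
  "gn Z2 * (gn X2 ^ n * b) = scal (\<i> ^ n) * (gn X1 ^ n * (gn Z2 * b))"
  "gn Z2 * (gn Y1 ^ n * b) = gn Y1 ^ n * (gn Z2 * b)" "gn Z2 * (gn Y2 ^ n * b) = gn Y2 ^ n * (gn Z2 * b)"
  "gn Z2 * (gn Z1 ^ n * b) = scal ((-1) ^ n) * (gn Z1 ^ n * (gn Z2 * b))"
  using power_move[of "gn X2" "gn X1" 1 "gn X1"] power_move[of "gn Y1" "gn X1" 1 "gn X2"]
    power_move[of "gn Y1" "gn X2" 1 "gn X1"] power_move[of "gn Y2" "gn X1" "-1" "gn X2"]
    power_move[of "gn Y2" "gn X2" "-1" "gn X1"] power_move[of "gn Y2" "gn Y1" 1 "gn Y1"]
    power_move[of "gn Z1" "gn X1" "-\<i>" "gn X2"] power_move[of "gn Z1" "gn X2" "-\<i>" "gn X1"]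
    power_move[of "gn Z1" "gn Y1" 1 "gn Y1"] power_move[of "gn Z1" "gn Y2" 1 "gn Y2"]
    power_move[of "gn Z2" "gn X1" "\<i>" "gn X2"] power_move[of "gn Z2" "gn X2" "\<i>" "gn X1"]
    power_move[of "gn Z2" "gn Y1" 1 "gn Y1"] power_move[of "gn Z2" "gn Y2" 1 "gn Y2"]
    power_move[of "gn Z2" "gn Z1" "-1" "gn Z1"]
  by (simp_all add: B_relations)

lemma X_powers_commute: "gn X2 ^ n * (gn X1 ^ m * b) = gn X1 ^ m * (gn X2 ^ n * b)"
  by (induction n arbitrary: b) (simp_all add: power_Suc2 mult.assoc gn_power_move del: power_Suc)

lemma scal_left_commute: "b * (scal c * d) = scal c * (b * d)"
  by (metis mult.assoc scal_commute)

text \<open>A \<open>y\<close> or \<open>z\<close> that comes from the left exchanges the two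
  exponents of \<open>x\<close>, with one scalar for each letter passed. The factor
  \<open>(-1) ^ e\<close> arises when \<open>z2\<close> passes \<open>z1 ^ e\<close>.\<close>

lemma gn_mult_mon:
  "gn X1 * mon a b c d e f = mon (Suc a) b c d e f"
  "gn X2 * mon a b c d e f = mon a (Suc b) c d e f"
  "gn Y1 * mon a b c d e f = mon b a (Suc c) d e f"
  "gn Y2 * mon a b c d e f = scal ((-1) ^ (a + b)) * mon b a c (Suc d) e f"
  "gn Z1 * mon a b c d e f = scal ((-\<i>) ^ (a + b)) * mon b a c d (Suc e) f"
  "gn Z2 * mon a b c d e f = scal (\<i> ^ (a + b) * (-1) ^ e) * mon b a c d e (Suc f)"
  unfolding mon_def
  by (simp_all add: gn_power_move mult.assoc X_powers_commute scal_left_commute[of "gn _ ^ _"] power_add)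

section \<open>The grade of a sorted monomial\<close>

lemma grp_mult_assoc: "grp_mult (grp_mult x y) z = grp_mult x (grp_mult y z)"
proof -
  obtain a b where x: "x = (a, b)" by (cases x)
  obtain c d where y: "y = (c, d)" by (cases y)
  obtain e f where z: "z = (e, f)" by (cases z)
  have mod4: "(k mod 4 + m + n) mod 4 = (k + m + n) mod 4" "(k + m mod 4 + n) mod 4 = (k + m + n) mod 4"
    "(k + 3 * (m mod 4) + n) mod 4 = (k + 3 * m + n) mod 4" for k m n :: nat
    by (intro mod_add_cong mod_mult_cong refl; simp)+
  have red: "fst (grp_mult (grp_mult x y) z) =
      (a + (if b then 3 * c else c) + (if b \<and> d then 2 else 0) + (if b \<noteq> d then 3 * e else e)
        + (if (b \<noteq> d) \<and> f then 2 else 0)) mod 4"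
    "fst (grp_mult x (grp_mult y z)) =
      (a + (if b then 3 else 1) * (c + (if d then 3 * e else e) + (if d \<and> f then 2 else 0))
        + (if b \<and> (d \<noteq> f) then 2 else 0)) mod 4"
    unfolding grp_mult_def x y z by (cases b; cases "d \<noteq> f"; simp only: split_def fst_conv snd_conv if_True if_False mod4 simp_thms mult_1)+
  have "fst (grp_mult (grp_mult x y) z) = fst (grp_mult x (grp_mult y z))"
  proof (cases "b \<and> d")
    \<comment> \<open>Conjugating twice turns \<open>e\<close> into \<open>9 * e\<close>; the two
      exponents differ by \<open>8 * e\<close>, and by 4 more if \<open>f\<close> holds.\<close>
    case True
    then show ?thesis
      using mod_mult_self2[of "a + 3 * c + 2 + e" 4 "2 * e + (if f then 1 else 0)"] unfolding red
      by (cases f) (simp_all add: algebra_simps)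
  next
    case False
    then show ?thesis
      unfolding red by (cases b; cases d; cases f) (simp_all add: algebra_simps)
  qed
  moreover have "snd (grp_mult (grp_mult x y) z) = snd (grp_mult x (grp_mult y z))"
    by (auto simp: grp_mult_def x y z)
  ultimately show ?thesis by (rule prod_eqI)
qed

text \<open>Products are reduced modulo 4, so \<open>grp_e\<close> is a right unit only for reduced
  pairs; this is the role of the bound.\<close>

lemma foldl_grp_mult:
  assumes "fst x < 4"
  shows "foldl grp_mult x (map gen_grade w) = grp_mult x (word_grade w)"
  using assms
proof (induction w arbitrary: x)
  case Nil
  then show ?case by (auto simp: word_grade_def grp_mult_def grp_e_def split: prod.splits)
next
  case (Cons g w)
  have "fst (grp_mult y z) < 4" for y z
    by (auto simp: grp_mult_def split: prod.splits)
  then have *: "foldl grp_mult (grp_mult y (gen_grade g)) (map gen_grade w) = grp_mult (grp_mult y (gen_grade g)) (word_grade w)" for y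
    by (rule Cons.IH)
  have "grp_mult grp_e (gen_grade g) = gen_grade g"
    by (cases g) (auto simp: grp_mult_def grp_e_def)
  with *[of x] *[of grp_e] show ?case by (simp add: word_grade_def grp_mult_assoc)
qed

lemma word_grade_append: "word_grade (u @ v) = grp_mult (word_grade u) (word_grade v)"
proof -
  have "fst (word_grade u) < 4"
    by (cases u rule: rev_cases) (auto simp: word_grade_def grp_e_def grp_mult_def split: prod.splits)
  from foldl_grp_mult[OF this, of v] show ?thesis
    by (simp add: word_grade_def)
qed

lemma word_grade_single: "word_grade [g] = gen_grade g"
  by (cases g) (auto simp: word_grade_def grp_mult_def grp_e_def)

lemma word_grade_Cons: "word_grade (g # w) = grp_mult (gen_grade g) (word_grade w)"
  using word_grade_append[of "[g]" w] by (simp add: word_grade_single)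

text \<open>Three bits describe the eight group elements. Grades of \<open>x\<close> have an even
  exponent of \<open>r\<close>, those of \<open>y\<close> and \<open>z\<close> an odd one, so the
  parities \<open>n\<close> and \<open>t\<close> of the degree in \<open>x\<close> and in the rest
  fix the coset of the centre, and \<open>p\<close> counts \<open>r^2\<close>. Choosing 1 or 3
  according to \<open>n\<close> lets each letter act by flipping bits.\<close>

definition grade_of_parities :: "bool \<Rightarrow> bool \<Rightarrow> bool \<Rightarrow> grp" where
  "grade_of_parities n t p = (((if p then 2 else 0) + (if t then (if n then 1 else 3) else 0)) mod 4, n \<noteq> t)"

lemma grp_mult_grade_of_parities:
  "grp_mult (gen_grade X1) (grade_of_parities n t p) = grade_of_parities (\<not> n) t (p \<noteq> (n \<noteq> t))"
  "grp_mult (gen_grade X2) (grade_of_parities n t p) = grade_of_parities (\<not> n) t (p \<noteq> (n = t))"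
  "grp_mult (gen_grade Y1) (grade_of_parities n t p) = grade_of_parities n (\<not> t) (p \<noteq> t)"
  "grp_mult (gen_grade Y2) (grade_of_parities n t p) = grade_of_parities n (\<not> t) (p = t)"
  "grp_mult (gen_grade Z1) (grade_of_parities n t p) = grade_of_parities n (\<not> t) (p \<noteq> t)"
  "grp_mult (gen_grade Z2) (grade_of_parities n t p) = grade_of_parities n (\<not> t) (p = t)"
  unfolding grade_of_parities_def grp_mult_def by (cases n; cases t; cases p; simp)+

text \<open>A product of \<open>n\<close> factors \<open>r^k_1 s, ..., r^k_n s\<close> equals \<open>r^(k_1 - k_2 + k_3 - ... + 2 (n div 2)) s^n\<close>.\<close>
definition mon_grade :: "nat \<Rightarrow> nat \<Rightarrow> nat \<Rightarrow> nat \<Rightarrow> nat \<Rightarrow> nat \<Rightarrow> grp" where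
  "mon_grade a b c d e f = grade_of_parities (odd (a + b)) (odd (c + d + e + f))
     (odd (b + d + f + (a + b + c + d + e + f) div 2))"

text \<open>The exchange of \<open>a\<close> and \<open>b\<close> is the one in
  \<open>gn_mult_mon\<close>, so sorting respects the grade. \<open>Suc S div 2\<close> exceeds
  \<open>S div 2\<close> exactly for odd \<open>S\<close>, and the parity of \<open>S\<close> can be
  read off from the first two bits.\<close>

lemma mon_grade_Suc:
  "mon_grade (Suc a) b c d e f = grp_mult (gen_grade X1) (mon_grade a b c d e f)"
  "mon_grade a (Suc b) c d e f = grp_mult (gen_grade X2) (mon_grade a b c d e f)"
  "mon_grade b a (Suc c) d e f = grp_mult (gen_grade Y1) (mon_grade a b c d e f)"
  "mon_grade b a c (Suc d) e f = grp_mult (gen_grade Y2) (mon_grade a b c d e f)"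
  "mon_grade b a c d (Suc e) f = grp_mult (gen_grade Z1) (mon_grade a b c d e f)"
  "mon_grade b a c d e (Suc f) = grp_mult (gen_grade Z2) (mon_grade a b c d e f)"
proof -
  define S where "S = a + b + c + d + e + f"
  have S: "even S \<longleftrightarrow> (even (a + b) \<longleftrightarrow> even (c + d + e + f))"
    unfolding S_def by (simp only: even_add) argo
  have h: "even (Suc S div 2) \<longleftrightarrow> (even (S div 2) \<longleftrightarrow> even S)"
    by (cases "even S") simp_all
  have sums: "Suc a + b + c + d + e + f = Suc S" "a + Suc b + c + d + e + f = Suc S"
    "b + a + Suc c + d + e + f = Suc S" "b + a + c + Suc d + e + f = Suc S"
    "b + a + c + d + Suc e + f = Suc S" "b + a + c + d + e + Suc f = Suc S"
    by (simp_all add: S_def)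
  show "mon_grade (Suc a) b c d e f = grp_mult (gen_grade X1) (mon_grade a b c d e f)"
    "mon_grade a (Suc b) c d e f = grp_mult (gen_grade X2) (mon_grade a b c d e f)"
    "mon_grade b a (Suc c) d e f = grp_mult (gen_grade Y1) (mon_grade a b c d e f)"
    "mon_grade b a c (Suc d) e f = grp_mult (gen_grade Y2) (mon_grade a b c d e f)"
    "mon_grade b a c d (Suc e) f = grp_mult (gen_grade Z1) (mon_grade a b c d e f)"
    "mon_grade b a c d e (Suc f) = grp_mult (gen_grade Z2) (mon_grade a b c d e f)"
    unfolding mon_grade_def grp_mult_grade_of_parities sums S_def[symmetric]
    by (rule arg_cong3[where f = grade_of_parities]; simp only: even_add even_Suc h S; argo)+
qed

lemma word_eq_mon:
  "\<exists>k a b c d e f. cls (fa_word w) = scal k * mon a b c d e f \<and> word_grade w = mon_grade a b c d e f"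
proof (induction w)
  case Nil
  have "cls (fa_word []) = scal 1 * mon 0 0 0 0 0 0" "word_grade [] = mon_grade 0 0 0 0 0 0"
    by (simp_all add: cls_word_Nil mon_def word_grade_def mon_grade_def grade_of_parities_def grp_e_def)
  then show ?case by blast
next
  case (Cons g w)
  then obtain k a b c d e f where *: "cls (fa_word w) = scal k * mon a b c d e f" "word_grade w = mon_grade a b c d e f"
    by blast
  have "\<exists>k' a' b' c' d' e' f'. gn g * mon a b c d e f = scal k' * mon a' b' c' d' e' f' \<and>
      grp_mult (gen_grade g) (mon_grade a b c d e f) = mon_grade a' b' c' d' e' f'"
    by (cases g) (metis gn_mult_mon mon_grade_Suc scal_simps(2) mult_1)+
  then obtain k' a' b' c' d' e' f' where **: "gn g * mon a b c d e f = scal k' * mon a' b' c' d' e' f'"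
      "grp_mult (gen_grade g) (mon_grade a b c d e f) = mon_grade a' b' c' d' e' f'" by blast
  have "cls (fa_word (g # w)) = scal (k * k') * mon a' b' c' d' e' f'"
    by (simp add: cls_word_Cons * **)
  with ** show ?case by (metis word_grade_Cons *(2))
qed

lemma mon_grade_e:
  assumes "mon_grade a b c d e f = grp_e"
  shows "even (a + b)" "even (c + d + e + f)" "even (b + d + f + (a + b + c + d + e + f) div 2)"
proof -
  have "grade_of_parities n t p = grp_e \<Longrightarrow> \<not> n \<and> \<not> t \<and> \<not> p" for n t p
    by (cases n; cases t; cases p; simp add: grade_of_parities_def grp_e_def)
  from this[OF assms[unfolded mon_grade_def]] show "even (a + b)" "even (c + d + e + f)"
    "even (b + d + f + (a + b + c + d + e + f) div 2)" by blast+
qed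

section \<open>Averaging over the group\<close>

definition avg :: "balg \<Rightarrow> balg" where
  "avg b = (let c = b + ract b; d = c + ract (ract c) in d + sact d)"

lemma avg_hom: "avg (a + b) = avg a + avg b" "avg (scal c * a) = scal c * avg a"
  by (simp_all add: avg_def Let_def algebra_simps)

lemma avg_sum: "avg (sum f S) = (\<Sum>x\<in>S. avg (f x))"
  by (induction S rule: infinite_finite_induct) (simp_all add: avg_hom, simp_all add: avg_def)

text \<open>The factor is the order of the group: \<open>avg\<close> applies \<open>1 + r\<close>,
  \<open>1 + r^2\<close> and \<open>1 + s\<close> in turn, without division.\<close>

lemma avg_invariant: "ract b = b \<Longrightarrow> sact b = b \<Longrightarrow> avg b = scal 8 * b"
proof -
  have "x + x = scal 2 * x" for x
    using scal_add[of 1 1] by (simp add: distrib_right flip: mult_2)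
  then show "ract b = b \<Longrightarrow> sact b = b \<Longrightarrow> avg b = scal 8 * b"
    by (simp add: avg_def Let_def)
qed

text \<open>\<open>r^2\<close> fixes each \<open>y\<close> and negates each \<open>x\<close> and
  each \<open>z\<close>.\<close>

lemma ract_ract_mon:
  "ract (ract (mon a b c d e f)) = scal ((-1) ^ (a + b + e + f)) * mon a b c d e f"
proof -
  have p: "(scal c * b) ^ n = scal (c ^ n) * b ^ n" for c b n
    by (induction n) (simp_all add: mult.assoc scal_left_commute[of b])
  have m: "(- b) ^ n = scal ((-1) ^ n) * b ^ n" for b n
    using p[of "-1" b n] by simp
  have i: "(scal c * b) * d = scal c * (b * d)" for c b d by (simp add: mult.assoc)
  have "(-1) ^ b * ((-1) ^ c * ((-1) ^ d * ((-1) ^ e * \<i> ^ e * ((-1) ^ f * \<i> ^ f)))) *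
      ((-1) ^ a * ((-1) ^ c * ((-1) ^ d * ((-1) ^ e * \<i> ^ e * ((-1) ^ f * \<i> ^ f))))) =
      (-1) ^ a * (-1) ^ b * ((-1) ^ c * (-1) ^ c) * ((-1) ^ d * (-1) ^ d) *
      ((-1) ^ e * (-1) ^ e * (\<i> ^ e * \<i> ^ e)) * ((-1) ^ f * (-1) ^ f * (\<i> ^ f * \<i> ^ f))"
    by (simp only: mult_ac)
  also have "\<dots> = (-1) ^ (a + b + e + f)"
    by (simp add: power_add flip: power_mult_distrib)
  finally show ?thesis
    unfolding mon_def by (simp add: p m i scal_left_commute[of "gn _ ^ _"])
qed

lemma orbit_sum_in_inv_alg:
  assumes "even (n + k + m)"
    and X: "(X, X') = (sq X1, sq X2) \<or> (X, X') = (sq X2, sq X1)"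
    and Y: "(Y, Y') = (sq Y1, sq Y2) \<or> (Y, Y') = (sq Y2, sq Y1)"
    and Z: "(Z, Z') = (sq Z1, sq Z2) \<or> (Z, Z') = (sq Z2, sq Z1)"
    and M: "M = eu ^ i * X ^ n * (ev ^ j * Y ^ k) * (ew ^ l * Z ^ m)"
  shows "Rep_evn (M + eract M + (esact M + esact (eract M))) \<in> inv_alg"
proof -
  have acts: "eract X = X'" "esact X = - X" "esact X' = - X'" "eract Y = Y'" "esact Y = Y'" "esact Y' = Y"
    "eract Z = - Z'" "esact Z = Z'" "esact Z' = Z"
    using X Y Z by auto
  \<comment> \<open>\<open>\<sigma>\<close> is the sign with which \<open>rs\<close> replaces
    \<open>X\<close> by \<open>X'\<close>, and \<open>\<tau>\<close> the sign with which
    \<open>s\<close> replaces \<open>Y\<close>, \<open>Z\<close> by \<open>Y'\<close>,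
    \<open>Z'\<close>. The sign of \<open>r\<close> is their product, so the four terms
    factor.\<close>
  define \<sigma> \<tau> :: evn where "\<sigma> = (-1) ^ (i + m + n)" and "\<tau> = (-1) ^ n"
  have sg: "\<sigma> = 1 \<or> \<sigma> = -1" "\<tau> = 1 \<or> \<tau> = -1"
    by (auto simp: \<sigma>_def \<tau>_def minus_one_power_iff)
  have sum: "M + eract M + (esact M + esact (eract M)) =
      ev ^ j * ew ^ l * (eu ^ i * (X ^ n + \<sigma> * X' ^ n) * (Y ^ k * Z ^ m + \<tau> * Y' ^ k * Z' ^ m))"
    unfolding M \<sigma>_def \<tau>_def power_add
    by (simp add: acts power_minus[of eu] power_minus[of X] power_minus[of X'] power_minus[of Z'] power_minus[of Z])
       (cases "even i"; cases "even m"; cases "even n"; simp add: algebra_simps)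
  \<comment> \<open>Since \<open>\<sigma>\<close> squares to 1, exchanging the two summands costs
    only the factor \<open>\<sigma>\<close>, and the index 1 can be put in front.\<close>
  have "\<exists>s. (s = 1 \<or> s = -1) \<and> X ^ n + \<sigma> * X' ^ n = s * (sq X1 ^ n + \<sigma> * sq X2 ^ n)"
    using X
  proof (elim disjE)
    assume "(X, X') = (sq X2, sq X1)"
    then show ?thesis using sg(1) by (intro exI[of _ \<sigma>]) (auto simp: algebra_simps)
  qed (auto intro: exI[of _ 1])
  then obtain s where s: "s = 1 \<or> s = -1" "X ^ n + \<sigma> * X' ^ n = s * (sq X1 ^ n + \<sigma> * sq X2 ^ n)"
    by blast
  have "\<exists>s. (s = 1 \<or> s = -1) \<and> (Y ^ k * Z ^ m + \<tau> * Y' ^ k * Z' ^ m = s * (sq Y1 ^ k * sq Z1 ^ m + \<tau> * sq Y2 ^ k * sq Z2 ^ m)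
     \<or> Y ^ k * Z ^ m + \<tau> * Y' ^ k * Z' ^ m = s * (sq Y1 ^ k * sq Z2 ^ m + \<tau> * sq Y2 ^ k * sq Z1 ^ m))"
    using Y
  proof (elim disjE)
    assume "(Y, Y') = (sq Y2, sq Y1)"
    then show ?thesis using Z sg(2) by (intro exI[of _ \<tau>]) (auto simp: algebra_simps)
  qed (use Z in \<open>auto intro: exI[of _ 1]\<close>)
  then obtain t where t: "t = 1 \<or> t = -1"
    "Y ^ k * Z ^ m + \<tau> * Y' ^ k * Z' ^ m = t * (sq Y1 ^ k * sq Z1 ^ m + \<tau> * sq Y2 ^ k * sq Z2 ^ m)
     \<or> Y ^ k * Z ^ m + \<tau> * Y' ^ k * Z' ^ m = t * (sq Y1 ^ k * sq Z2 ^ m + \<tau> * sq Y2 ^ k * sq Z1 ^ m)"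
    by blast
  have "C * (D * (s * E) * (t * F)) = C * (s * t) * (D * E * F)" for C D E F :: evn
    by (simp only: mult_ac)
  note sum' = sum[unfolded s(2)] this
  from t(2) have "M + eract M + (esact M + esact (eract M)) = ev ^ j * ew ^ l * (s * t) *
        (eu ^ i * (sq X1 ^ n + \<sigma> * sq X2 ^ n) * (sq Y1 ^ k * sq Z1 ^ m + \<tau> * sq Y2 ^ k * sq Z2 ^ m)) \<or>
     M + eract M + (esact M + esact (eract M)) = ev ^ j * ew ^ l * (s * t) *
        (eu ^ i * (sq X1 ^ n + \<sigma> * sq X2 ^ n) * (sq Y1 ^ k * sq Z2 ^ m + \<tau> * sq Y2 ^ k * sq Z1 ^ m))"
    by (elim disjE) (simp_all only: sum' simp_thms)
  moreover have "ev ^ j * ew ^ l * (s * t) \<in> {e. Rep_evn e \<in> inv_alg}"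
    using s(1) t(1) inv_alg_scal[of 1] inv_alg_scal[of "-1"]
    by (intro inv_alg.mult inv_alg.power inv_alg.g1 inv_alg.g2) auto
  ultimately have "M + eract M + (esact M + esact (eract M)) \<in> {e. Rep_evn e \<in> inv_alg}"
    using inv_alg.orbit_sum_mem[OF assms(1), of i] unfolding inv_alg.YZ_both_def \<sigma>_def[symmetric] \<tau>_def[symmetric]
    by (elim disjE) (simp_all only: inv_alg.mult)
  then show ?thesis by simp
qed

text \<open>The smaller exponent becomes the power \<open>i\<close> of the product, and the even
  excess a power of one square. The case \<open>t = -1\<close> is for \<open>z1\<close> and
  \<open>z2\<close>.\<close>

lemma square_power_split:
  assumes ab: "gn B * gn A = scal t * (gn A * gn B)" and e: "even (a + b)" and t: "t\<^sup>2 = 1"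
  shows "\<exists>\<kappa> i n C. gn A ^ a * gn B ^ b = scal \<kappa> * ((gn A * gn B) ^ i * ((gn C)\<^sup>2) ^ n) \<and>
      (C = A \<and> a = i + 2 * n \<and> b = i \<or> C = B \<and> a = i \<and> b = i + 2 * n)"
proof -
  have tt: "scal t * (scal t * x) = x" for x
    using t by (simp add: power2_eq_square)
  have "gn A * (gn A * gn B) = scal t * (scal t * (gn A * (gn A * gn B)))"
    unfolding tt ..
  also have "\<dots> = scal t * (gn A * gn B * gn A)"
    using ab by (simp add: mult.assoc)
  finally have move: "gn A * (gn A * gn B) = scal t * (gn A * gn B * gn A)" .
  have key: "\<exists>\<kappa>. gn A ^ i * gn B ^ i = scal \<kappa> * (gn A * gn B) ^ i" for i
  proof (induction i)
    case (Suc i)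
    then obtain \<kappa> where \<kappa>: "gn A ^ i * gn B ^ i = scal \<kappa> * (gn A * gn B) ^ i" by blast
    have "gn A ^ Suc i * gn B ^ Suc i = gn A * (gn A ^ i * gn B ^ i) * gn B"
      by (metis mult.assoc power_Suc power_Suc2)
    also have "\<dots> = scal \<kappa> * (gn A * ((gn A * gn B) ^ i * gn B))"
      unfolding \<kappa> by (simp add: mult.assoc)
    also have "\<dots> = scal (\<kappa> * t ^ i) * (gn A * gn B) ^ Suc i"
      unfolding power_move[OF move] by (simp add: power_Suc2 del: power_Suc)
    finally show ?case by blast
  qed (auto intro: exI[of _ 1])
  consider i n where "a = i + 2 * n" "b = i" | i n where "a = i" "b = i + 2 * n"
    using e by (metis le_add_diff_inverse nat_le_linear even_add even_diff_nat evenE add.commute)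
  then show ?thesis
  proof cases
    case (1 i n)
    obtain \<kappa> where \<kappa>: "gn A ^ i * gn B ^ i = scal \<kappa> * (gn A * gn B) ^ i" using key by blast
    have "(gn A)\<^sup>2 * (gn A * gn B) = gn A * (scal t * (gn A * gn B * gn A))"
      unfolding move[symmetric] by (simp add: power2_eq_square mult.assoc)
    also have "\<dots> = scal t * ((gn A * (gn A * gn B)) * gn A)"
      by (simp add: mult.assoc)
    also have "\<dots> = (gn A * gn B) * (gn A)\<^sup>2"
      unfolding move using tt by (simp add: power2_eq_square mult.assoc)
    finally have "((gn A)\<^sup>2) ^ n * (gn A * gn B) ^ i = (gn A * gn B) ^ i * ((gn A)\<^sup>2) ^ n"
      by (metis power_commuting_commutes)
    moreover have "gn A ^ a * gn B ^ b = ((gn A)\<^sup>2) ^ n * (gn A ^ i * gn B ^ i)"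
      unfolding 1 by (simp add: mult.assoc flip: power_mult power_add) (simp add: add.commute flip: mult.assoc power_add)
    ultimately have "gn A ^ a * gn B ^ b = scal \<kappa> * ((gn A * gn B) ^ i * ((gn A)\<^sup>2) ^ n)"
      by (simp add: \<kappa> scal_left_commute[of "_ ^ n"])
    with 1 show ?thesis by blast
  next
    case (2 i n)
    obtain \<kappa> where \<kappa>: "gn A ^ i * gn B ^ i = scal \<kappa> * (gn A * gn B) ^ i" using key by blast
    have "gn A ^ a * gn B ^ b = gn A ^ i * gn B ^ i * ((gn B)\<^sup>2) ^ n"
      unfolding 2 by (simp add: mult.assoc power_add power_mult)
    then have "gn A ^ a * gn B ^ b = scal \<kappa> * ((gn A * gn B) ^ i * ((gn B)\<^sup>2) ^ n)"
      by (simp add: \<kappa> mult.assoc)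
    with 2 show ?thesis by blast
  qed
qed

lemma avg_mon:
  assumes "mon_grade a b c d e f = grp_e"
  shows "avg (mon a b c d e f) \<in> inv_alg"
proof -
  note par = mon_grade_e[OF assms]
  let ?m = "mon a b c d e f"
  have rr: "ract (ract ?m) = scal ((-1) ^ (e + f)) * ?m"
    using ract_ract_mon[of a b c d e f] par(1) by (simp add: power_add minus_one_power_iff)
  show ?thesis
  proof (cases "even (e + f)")
    case False
    then have "ract (ract ?m) = - ?m" using rr by simp
    then have "avg ?m = 0" by (simp add: avg_def Let_def)
    then show ?thesis using inv_alg_scal[of 0] by simp
  next
    case True
    then have cd: "even (c + d)" using par(2) by (simp only: even_add) argo
    obtain \<kappa>1 i n C1 where 1: "gn X1 ^ a * gn X2 ^ b = scal \<kappa>1 * (bu ^ i * ((gn C1)\<^sup>2) ^ n)"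
        "C1 = X1 \<and> a = i + 2 * n \<and> b = i \<or> C1 = X2 \<and> a = i \<and> b = i + 2 * n"
      using square_power_split[of X2 X1 1 a b] par(1) by (auto simp: B_relations)
    obtain \<kappa>2 j k C2 where 2: "gn Y1 ^ c * gn Y2 ^ d = scal \<kappa>2 * (bv ^ j * ((gn C2)\<^sup>2) ^ k)"
        "C2 = Y1 \<and> c = j + 2 * k \<and> d = j \<or> C2 = Y2 \<and> c = j \<and> d = j + 2 * k"
      using square_power_split[of Y2 Y1 1 c d] cd by (auto simp: B_relations)
    obtain \<kappa>3 l m C3 where 3: "gn Z1 ^ e * gn Z2 ^ f = scal \<kappa>3 * (bw ^ l * ((gn C3)\<^sup>2) ^ m)"
        "C3 = Z1 \<and> e = l + 2 * m \<and> f = l \<or> C3 = Z2 \<and> e = l \<and> f = l + 2 * m"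
      using square_power_split[of Z2 Z1 "-1" e f] True by (auto simp: B_relations)
    define M where "M = eu ^ i * sq C1 ^ n * (ev ^ j * sq C2 ^ k) * (ew ^ l * sq C3 ^ m)"
    \<comment> \<open>Half the degree is a sum of six exponents. As \<open>b\<close>,
      \<open>d\<close>, \<open>f\<close> have the parities of \<open>i\<close>, \<open>j\<close>,
      \<open>l\<close>, the neutral grade leaves the condition on \<open>n + k + m\<close>.\<close>
    have "a + b + c + d + e + f = 2 * (i + n + j + k + l + m)"
      using 1(2) 2(2) 3(2) by auto
    then have "even (b + d + f + (i + n + j + k + l + m))"
      using par(3) by simp
    moreover have "even b = even i" "even d = even j" "even f = even l"
      using 1(2) 2(2) 3(2) by auto
    ultimately have nkm: "even (n + k + m)"
      by (simp only: even_add) argo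
    have "?m = (gn X1 ^ a * gn X2 ^ b) * ((gn Y1 ^ c * gn Y2 ^ d) * (gn Z1 ^ e * gn Z2 ^ f))"
      by (simp add: mon_def mult.assoc)
    also have "\<dots> = scal (\<kappa>1 * \<kappa>2 * \<kappa>3) * Rep_evn M"
      unfolding 1(1) 2(1) 3(1) M_def Rep_evn_hom Rep_evn_power Rep_evn_gens
      by (simp add: mult.assoc scal_left_commute[of "(_ * _) ^ _"] scal_left_commute[of "(_\<^sup>2) ^ _"])
    finally have m: "?m = scal (\<kappa>1 * \<kappa>2 * \<kappa>3) * Rep_evn M" .
    \<comment> \<open>Here \<open>r^2\<close> fixes the monomial, so the eight terms are the four of
      the orbit sum, each taken twice.\<close>
    have "avg ?m = (?m + ract ?m + sact (?m + ract ?m)) + (?m + ract ?m + sact (?m + ract ?m))"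
      using rr True by (simp add: avg_def Let_def add_ac)
    also have "?m + ract ?m + sact (?m + ract ?m) =
        scal (\<kappa>1 * \<kappa>2 * \<kappa>3) * Rep_evn (M + eract M + (esact M + esact (eract M)))"
      unfolding m by (simp add: eract.rep_eq esact.rep_eq distrib_left)
    finally have avg: "avg ?m = scal (\<kappa>1 * \<kappa>2 * \<kappa>3) * Rep_evn (M + eract M + (esact M + esact (eract M)))
        + scal (\<kappa>1 * \<kappa>2 * \<kappa>3) * Rep_evn (M + eract M + (esact M + esact (eract M)))" .
    have "Rep_evn (M + eract M + (esact M + esact (eract M))) \<in> inv_alg"
    proof (rule orbit_sum_in_inv_alg[OF nkm _ _ _ M_def])
      show "(sq C1, if C1 = X1 then sq X2 else sq X1) = (sq X1, sq X2) \<or>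
          (sq C1, if C1 = X1 then sq X2 else sq X1) = (sq X2, sq X1)"
        using 1(2) by auto
      show "(sq C2, if C2 = Y1 then sq Y2 else sq Y1) = (sq Y1, sq Y2) \<or>
          (sq C2, if C2 = Y1 then sq Y2 else sq Y1) = (sq Y2, sq Y1)"
        using 2(2) by auto
      show "(sq C3, if C3 = Z1 then sq Z2 else sq Z1) = (sq Z1, sq Z2) \<or>
          (sq C3, if C3 = Z1 then sq Z2 else sq Z1) = (sq Z2, sq Z1)"
        using 3(2) by auto
    qed
    then show ?thesis
      unfolding avg by (intro inv_alg_add inv_alg_mult inv_alg_scal)
  qed
qed

text \<open>Averaging multiplies an invariant by 8 and can be done word by word; homogeneity of the
  representative makes every word neutral.\<close>

lemma invariant_in_inv_alg:
  assumes "fa_homog_e q" "ract (cls q) = cls q" "sact (cls q) = cls q"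
  shows "cls q \<in> inv_alg"
proof -
  have fin: "fa_fin q" and gr: "\<And>w. q w \<noteq> 0 \<Longrightarrow> word_grade w = grp_e"
    using assms(1) by (auto simp: fa_homog_e_def)
  have "avg (cls (fa_word w)) \<in> inv_alg" if "q w \<noteq> 0" for w
    using word_eq_mon[of w] gr[OF that] avg_mon
    by (metis avg_hom(2) inv_alg_mult inv_alg_scal)
  then have "(\<Sum>w\<in>S. scal (q w) * avg (cls (fa_word w))) \<in> inv_alg" if "S \<subseteq> {w. q w \<noteq> 0}" for S
    using that inv_alg_scal[of 0]
    by (induction S rule: infinite_finite_induct) (auto intro!: inv_alg_add inv_alg_mult inv_alg_scal)
  then have "avg (cls q) \<in> inv_alg"
    by (subst cls_sum_words[OF fin]) (simp add: avg_sum avg_hom)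
  then have "scal 8 * cls q \<in> inv_alg"
    unfolding avg_invariant[OF assms(2,3)] .
  from inv_alg_mult[OF inv_alg_scal[of "1/8"] this] show ?thesis by simp
qed

section \<open>Homogeneous lifts and the equality with the invariants\<close>

definition homog :: "grp \<Rightarrow> fa \<Rightarrow> bool" where
  "homog g p \<longleftrightarrow> fa_fin p \<and> (\<forall>w. p w \<noteq> 0 \<longrightarrow> word_grade w = g)"

lemma homogI: "fa_fin p \<Longrightarrow> (\<And>w. p w \<noteq> 0 \<Longrightarrow> word_grade w = g) \<Longrightarrow> homog g p"
  by (simp add: homog_def)

lemma homogD: "homog g p \<Longrightarrow> fa_fin p" "homog g p \<Longrightarrow> p w \<noteq> 0 \<Longrightarrow> word_grade w = g"
  by (simp_all add: homog_def)

lemma homog_add: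
  assumes "homog g p" "homog g q"
  shows "homog g (p \<oplus> q)"
proof (rule homogI)
  fix w assume "(p \<oplus> q) w \<noteq> 0"
  then have "p w \<noteq> 0 \<or> q w \<noteq> 0" unfolding fa_add_def by force
  then show "word_grade w = g" using assms homogD(2) by blast
qed (use assms homogD(1) in simp)

lemma homog_diff:
  assumes "homog g p" "homog g q"
  shows "homog g (p \<ominus> q)"
proof (rule homogI)
  fix w assume "(p \<ominus> q) w \<noteq> 0"
  then have "p w \<noteq> 0 \<or> q w \<noteq> 0" unfolding fa_diff_def by force
  then show "word_grade w = g" using assms homogD(2) by blast
qed (use assms homogD(1) in simp)

lemma homog_mul:
  assumes "homog g p" "homog h q" "grp_mult g h = k"
  shows "homog k (p \<odot> q)"
proof (rule homogI)
  fix w assume "(p \<odot> q) w \<noteq> 0"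
  then obtain u v where "w = u @ v" "p u \<noteq> 0" "q v \<noteq> 0" using fa_mul_nonzero by blast
  then show "word_grade w = k"
    using homogD(2)[OF assms(1)] homogD(2)[OF assms(2)] assms(3) by (simp add: word_grade_append)
qed (use assms homogD(1) in simp)

lemma homog_const: "homog grp_e (fa_const c)"
  by (rule homogI) (simp, simp add: fa_const_def word_grade_def split: if_splits)

lemma homog_var: "homog (gen_grade a) (fa_var a)"
  by (rule homogI) (simp, simp add: fa_var_def word_grade_single split: if_splits)

lemma homog_e_iff: "fa_homog_e p \<longleftrightarrow> homog grp_e p"
  by (simp add: fa_homog_e_def homog_def)

lemma fa_pow_2_4: "fa_pow p 2 = p \<odot> p" "fa_pow p 4 = (p \<odot> p) \<odot> (p \<odot> p)"
  by (simp_all add: eval_nat_numeral fa_const_mul fa_mul_assoc)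

text \<open>The square of each variable has the grade \<open>r^2\<close>, which is an involution, so
  an even number of squares is neutral.\<close>

lemma homog_square: "homog (2, False) (fa_pow (fa_var a) 2)" "homog grp_e (fa_pow (fa_var a) 4)"
proof -
  show "homog (2, False) (fa_pow (fa_var a) 2)"
    unfolding fa_pow_2_4
    by (rule homog_mul[OF homog_var homog_var]) (cases a; simp add: grp_mult_def)
  from this[unfolded fa_pow_2_4] show "homog grp_e (fa_pow (fa_var a) 4)"
    unfolding fa_pow_2_4 using homog_mul[of "(2, False)" _ "(2, False)"] by (simp add: grp_mult_def grp_e_def)
qed

lemma homog_pair: "homog grp_e (x1 \<odot> x2)" "homog grp_e (y1 \<odot> y2)" "homog grp_e (z1 \<odot> z2)"
  by (rule homog_mul[OF homog_var homog_var], simp add: grp_mult_def grp_e_def)+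

lemma homog_e_mul: "homog grp_e p \<Longrightarrow> homog grp_e q \<Longrightarrow> homog grp_e (p \<odot> q)"
  by (erule homog_mul) (auto simp: grp_mult_def grp_e_def)

lemma homog_2_mul: "homog (2, False) p \<Longrightarrow> homog (2, False) q \<Longrightarrow> homog grp_e (p \<odot> q)"
  "homog grp_e p \<Longrightarrow> homog (2, False) q \<Longrightarrow> homog (2, False) (p \<odot> q)"
  "homog (2, False) p \<Longrightarrow> homog grp_e q \<Longrightarrow> homog (2, False) (p \<odot> q)"
  by (erule homog_mul, assumption, simp add: grp_mult_def grp_e_def)+

lemma homog_gB: "homog grp_e (gB n)"
  by (simp add: gB_def homog_const homog_add homog_diff homog_pair homog_square homog_e_mul homog_2_mul)

lemma gB_invariant: "ract (cls (gB n)) = cls (gB n)" "sact (cls (gB n)) = cls (gB n)"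
  unfolding gB_def
  by (auto simp: power2_eq_square power4_eq_xxxx sort_simps algebra_simps)

lemma B_subalg_eq_invariants: "B_subalg (gB ` {1..17}) = B_invariants"
proof (intro equalityI subsetI)
  fix p assume "p \<in> B_subalg (gB ` {1..17})"
  then obtain q where p: "fa_fin p" and q: "q \<in> fa_alg (gB ` {1..17})" and "B_eq p q"
    by (auto simp: B_subalg_def)
  then have pq: "cls p = cls q" using cls_eq_iff fa_alg_fin by blast
  have "homog grp_e q \<and> ract (cls q) = cls q \<and> sact (cls q) = cls q"
    using q by (induction rule: fa_alg.induct)
      (auto simp: fa_alg_fin gB_invariant intro: homog_const homog_gB homog_add homog_e_mul)
  then have "homog grp_e q" "ract (cls p) = cls p" "sact (cls p) = cls p"
    by (simp_all add: pq)
  moreover have "(ract ^^ k) (cls p) = cls p" for k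
    using \<open>ract (cls p) = cls p\<close> by (induction k) auto
  ultimately have "cls (act p g) = cls p" for g
    by (cases g) (simp add: cls_act[OF p])
  then have "B_eq (act p g) p" for g
    using cls_eq_iff[of "act p g" p] cls_act(1)[OF p] p by (cases g) auto
  with p \<open>B_eq p q\<close> \<open>homog grp_e q\<close> show "p \<in> B_invariants"
    by (auto simp: B_invariants_def homog_e_iff)
next
  fix p assume "p \<in> B_invariants"
  then obtain q where p: "fa_fin p" and q: "fa_homog_e q" "B_eq p q"
      and inv: "\<And>g. g \<in> grp_elems \<Longrightarrow> B_eq (act p g) p"
    by (auto simp: B_invariants_def)
  then have pq: "cls p = cls q" using cls_eq_iff[of p q] by (simp add: fa_homog_e_def)
  have "cls (act p g) = cls p" if "g \<in> grp_elems" for g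
    using inv[OF that] cls_eq_iff[of "act p g" p] cls_act(1)[OF p] p by (cases g) auto
  from this[of "(1, False)"] this[of "(0, True)"] have "ract (cls q) = cls q" "sact (cls q) = cls q"
    by (simp_all add: cls_act[OF p] grp_elems_def pq)
  then have "cls p \<in> inv_alg"
    using invariant_in_inv_alg q pq by simp
  then show "p \<in> B_subalg (gB ` {1..17})"
    using p fa_alg_fin cls_eq_iff by (auto simp: inv_alg_def B_subalg_def)
qed

section \<open>Normal form coefficients\<close>

type_synonym expo = "nat \<times> nat \<times> nat \<times> nat \<times> nat \<times> nat"

fun expo_Cons :: "gen \<Rightarrow> expo \<Rightarrow> expo" where
  "expo_Cons X1 (a, b, c, d, e, f) = (Suc a, b, c, d, e, f)"
| "expo_Cons X2 (a, b, c, d, e, f) = (a, Suc b, c, d, e, f)"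
| "expo_Cons Y1 (a, b, c, d, e, f) = (b, a, Suc c, d, e, f)"
| "expo_Cons Y2 (a, b, c, d, e, f) = (b, a, c, Suc d, e, f)"
| "expo_Cons Z1 (a, b, c, d, e, f) = (b, a, c, d, Suc e, f)"
| "expo_Cons Z2 (a, b, c, d, e, f) = (b, a, c, d, e, Suc f)"

fun coef_Cons :: "gen \<Rightarrow> expo \<Rightarrow> complex" where
  "coef_Cons X1 (a, b, c, d, e, f) = 1"
| "coef_Cons X2 (a, b, c, d, e, f) = 1"
| "coef_Cons Y1 (a, b, c, d, e, f) = 1"
| "coef_Cons Y2 (a, b, c, d, e, f) = (-1) ^ (a + b)"
| "coef_Cons Z1 (a, b, c, d, e, f) = (-\<i>) ^ (a + b)"
| "coef_Cons Z2 (a, b, c, d, e, f) = \<i> ^ (a + b) * (-1) ^ e"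

text \<open>The normal form of a word \<open>w\<close> is \<open>word_coef w\<close> times the sorted monomial with exponents
  \<open>word_expo w\<close>.\<close>
primrec word_expo :: "gen list \<Rightarrow> expo" where
  "word_expo [] = (0, 0, 0, 0, 0, 0)"
| "word_expo (g # w) = expo_Cons g (word_expo w)"

primrec word_coef :: "gen list \<Rightarrow> complex" where
  "word_coef [] = 1"
| "word_coef (g # w) = coef_Cons g (word_expo w) * word_coef w"

text \<open>The left factor exchanges the exponents of \<open>x\<close> in the right factor if it
  contains an odd number of \<open>y\<close> and \<open>z\<close>.\<close>

fun expo_mult :: "expo \<Rightarrow> expo \<Rightarrow> expo" where
  "expo_mult (a, b, c, d, e, f) (a', b', c', d', e', f') =
     (if even (c + d + e + f) then a + a' else a + b', if even (c + d + e + f) then b + b' else b + a',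
      c + c', d + d', e + e', f + f')"

text \<open>The scalar from sorting a product of two sorted monomials: every \<open>x\<close> on the
  right passes \<open>y2\<close>, \<open>z1\<close>, \<open>z2\<close> on the left at the cost of
  \<open>-1\<close>, \<open>-\<i>\<close>, \<open>\<i>\<close>, and \<open>z2 ^ f\<close> passes
  \<open>z1 ^ e'\<close>.\<close>

fun cocycle :: "expo \<Rightarrow> expo \<Rightarrow> complex" where
  "cocycle (a, b, c, d, e, f) (a', b', c', d', e', f') =
     ((-1) ^ d * (-\<i>) ^ e * \<i> ^ f) ^ (a' + b') * (-1) ^ (f * e')"

lemma expo_Cons_mult: "expo_Cons g (expo_mult m n) = expo_mult (expo_Cons g m) n"
  by (cases g; cases m rule: prod_cases6; cases n rule: prod_cases6) auto

lemma coef_Cons_mult: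
  "coef_Cons g (expo_mult m n) * cocycle m n = coef_Cons g m * cocycle (expo_Cons g m) n"
proof -
  obtain a b c d e f where m: "m = (a, b, c, d, e, f)" by (cases m rule: prod_cases6)
  obtain a' b' c' d' e' f' where n: "n = (a', b', c', d', e', f')" by (cases n rule: prod_cases6)
  \<comment> \<open>The exponents of \<open>x\<close> enter \<open>coef_Cons\<close> only through
    their sum, so the exchange is invisible.\<close>
  have eq: "coef_Cons g (expo_mult m n) = coef_Cons g (a + a', b + b', c + c', d + d', e + e', f + f')"
  proof (cases "even (c + d + e + f)")
    case True
    then have "expo_mult m n = (a + a', b + b', c + c', d + d', e + e', f + f')"
      unfolding m n by simp
    then show ?thesis by simp
  next
    case False
    then have "expo_mult m n = (a + b', b + a', c + c', d + d', e + e', f + f')"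
      unfolding m n by simp
    then show ?thesis by (cases g) (simp_all add: add_ac)
  qed
  show ?thesis
    unfolding eq unfolding m n
    by (cases g) (simp_all add: power_add power_mult_distrib mult_ac power_minus[of "_ * _"] power_minus[of \<i>])
qed

lemma word_expo_append: "word_expo (u @ v) = expo_mult (word_expo u) (word_expo v)"
  by (induction u) (simp_all add: expo_Cons_mult, cases "word_expo v" rule: prod_cases6, simp)

lemma word_coef_append: "word_coef (u @ v) = word_coef u * word_coef v * cocycle (word_expo u) (word_expo v)"
proof (induction u)
  case Nil
  show ?case by (cases "word_expo v" rule: prod_cases6) simp
next
  case (Cons g u)
  then show ?case
    using coef_Cons_mult[of g "word_expo u" "word_expo v"] by (simp add: word_expo_append mult_ac)
qed

fun expo_deg :: "expo \<Rightarrow> nat" where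
  "expo_deg (a, b, c, d, e, f) = a + b + c + d + e + f"

lemma expo_deg_word: "expo_deg (word_expo w) = length w"
proof (induction w)
  case (Cons g w)
  then show ?case by (cases g; cases "word_expo w" rule: prod_cases6) auto
qed simp

lemma finite_word_expo: "finite {w. word_expo w = m}"
  by (rule finite_subset[OF _ finite_words[of "expo_deg m"]]) (auto simp: expo_deg_word)

lemma finite_expo_mult: "finite {(m1, m2). expo_mult m1 m2 = m}"
proof -
  let ?I = "{..expo_deg m}"
  let ?E = "?I \<times> ?I \<times> ?I \<times> ?I \<times> ?I \<times> ?I"
  have "{(m1, m2). expo_mult m1 m2 = m} \<subseteq> ?E \<times> ?E"
    by (auto split: if_splits)
  moreover have "finite (?E \<times> ?E)" by (intro finite_cartesian_product) auto
  ultimately show ?thesis by (rule finite_subset)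
qed

definition nf_coeff :: "fa \<Rightarrow> expo \<Rightarrow> complex" where
  "nf_coeff p m = (\<Sum>w | word_expo w = m. word_coef w * p w)"

lemma nf_coeff_add: "nf_coeff (p \<oplus> q) m = nf_coeff p m + nf_coeff q m"
  by (simp add: nf_coeff_def fa_add_def distrib_left sum.distrib)

lemma nf_coeff_diff: "nf_coeff (p \<ominus> q) m = nf_coeff p m - nf_coeff q m"
  by (simp add: nf_coeff_def fa_diff_def right_diff_distrib sum_subtractf)

lemma nf_coeff_const_mul: "nf_coeff (fa_const c \<odot> p) m = c * nf_coeff p m"
  by (simp add: nf_coeff_def fa_const_mul sum_distrib_left mult_ac)

lemma nf_coeff_word: "nf_coeff (fa_word w) m = (if word_expo w = m then word_coef w else 0)"
proof -
  have "nf_coeff (fa_word w) m = (\<Sum>v\<in>{v. word_expo v = m}. if v = w then word_coef w else 0)"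
    unfolding nf_coeff_def by (intro sum.cong) (auto simp: fa_word_def)
  then show ?thesis by (simp add: finite_word_expo)
qed

lemma nf_coeff_const: "nf_coeff (fa_const c) m = (if m = (0, 0, 0, 0, 0, 0) then c else 0)"
proof -
  have "fa_const c = fa_const c \<odot> fa_word []"
    by (simp add: fa_const_mul flip: fa_const_word)
  then have "nf_coeff (fa_const c) m = c * nf_coeff (fa_word []) m"
    by (metis nf_coeff_const_mul)
  then show ?thesis by (simp add: nf_coeff_word)
qed

lemma nf_coeff_mul:
  "nf_coeff (p \<odot> q) m = (\<Sum>(m1, m2)\<in>{(m1, m2). expo_mult m1 m2 = m}. cocycle m1 m2 * (nf_coeff p m1 * nf_coeff q m2))"
proof -
  have "nf_coeff (p \<odot> q) m = (\<Sum>(a, b)\<in>{(a, b). word_expo (a @ b) = m}. word_coef (a @ b) * (p a * q b))"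
    unfolding nf_coeff_def using sum_fa_mul[OF finite_word_expo, where f = word_coef] by simp
  also have "\<dots> = (\<Sum>z\<in>(SIGMA x:{(m1, m2). expo_mult m1 m2 = m}. {a. word_expo a = fst x} \<times> {b. word_expo b = snd x}).
      cocycle (fst (fst z)) (snd (fst z)) *
        ((word_coef (fst (snd z)) * p (fst (snd z))) * (word_coef (snd (snd z)) * q (snd (snd z)))))"
    by (rule sum.reindex_bij_witness[of _ snd "\<lambda>(a, b). ((word_expo a, word_expo b), (a, b))"])
       (auto simp: word_expo_append word_coef_append mult_ac)
  also have "\<dots> = (\<Sum>x\<in>{(m1, m2). expo_mult m1 m2 = m}. \<Sum>y\<in>{a. word_expo a = fst x} \<times> {b. word_expo b = snd x}.
      cocycle (fst x) (snd x) * ((word_coef (fst y) * p (fst y)) * (word_coef (snd y) * q (snd y))))"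
    using finite_expo_mult finite_word_expo
    by (subst sum.Sigma) (auto intro!: sum.cong finite_cartesian_product)
  also have "\<dots> = (\<Sum>(m1, m2)\<in>{(m1, m2). expo_mult m1 m2 = m}. cocycle m1 m2 * (nf_coeff p m1 * nf_coeff q m2))"
    unfolding nf_coeff_def sum_product
    by (intro sum.cong refl) (auto simp: sum.cartesian_product sum_distrib_left split_def)
  finally show ?thesis .
qed

text \<open>The two words of a relation have the same sorted exponents and cancelling coefficients,
  and the product rule carries this to all multiples. Thus sorted coefficients are functions on
  \<open>B\<close>.\<close>

lemma nf_coeff_ideal: "p \<in> B_ideal \<Longrightarrow> nf_coeff p m = 0"
proof (induction arbitrary: m rule: B_ideal.induct)
  case (rel r)
  then show ?case
    by (auto simp: B_rels_def fa_mul_assoc fa_var_word fa_word_mul nf_coeff_add nf_coeff_diff nf_coeff_const_mul nf_coeff_word)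
qed (simp_all add: nf_coeff_const nf_coeff_add nf_coeff_mul split_def)

lemma nf_coeff_B_eq: "B_eq p q \<Longrightarrow> nf_coeff p = nf_coeff q"
  using nf_coeff_ideal[of "p \<ominus> q"] by (auto simp: B_eq_def nf_coeff_diff)

text \<open>Exponents of the monomials that are fixed by \<open>r\<^sup>2\<close> and have the neutral grade.\<close>
fun expo_neutral :: "expo \<Rightarrow> bool" where
  "expo_neutral (a, b, c, d, e, f) \<longleftrightarrow> even (a + b) \<and> even (c + d) \<and> even (e + f) \<and>
     even ((a + b) div 2 + b + ((c + d) div 2 + d) + ((e + f) div 2 + f))"

text \<open>Between neutral exponents the product is plain addition and only the sign of
  \<open>z2\<close> passing \<open>z1\<close> survives. Sums over a box can be expanded outright in
  a concrete degree.\<close>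

fun conv :: "(expo \<Rightarrow> complex) \<Rightarrow> (expo \<Rightarrow> complex) \<Rightarrow> expo \<Rightarrow> complex" where
  "conv F G (a, b, c, d, e, f) = (\<Sum>i\<le>a. \<Sum>j\<le>b. \<Sum>k\<le>c. \<Sum>l\<le>d. \<Sum>m\<le>e. \<Sum>n\<le>f.
     (-1) ^ (n * (e - m)) * (F (i, j, k, l, m, n) * G (a - i, b - j, c - k, d - l, e - m, f - n)))"

lemma nf_coeff_mul_conv:
  assumes p: "\<And>m. \<not> expo_neutral m \<Longrightarrow> nf_coeff p m = 0" and q: "\<And>m. \<not> expo_neutral m \<Longrightarrow> nf_coeff q m = 0"
  shows "nf_coeff (p \<odot> q) = conv (nf_coeff p) (nf_coeff q)"
proof
  fix M :: expo
  obtain a b c d e f where M: "M = (a, b, c, d, e, f)" by (cases M rule: prod_cases6)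
  let ?g = "\<lambda>(m1, m2). cocycle m1 m2 * (nf_coeff p m1 * nf_coeff q m2)"
  let ?T = "{(m1, m2). expo_mult m1 m2 = M \<and> expo_neutral m1 \<and> expo_neutral m2}"
  let ?P = "{..a} \<times> {..b} \<times> {..c} \<times> {..d} \<times> {..e} \<times> {..f}"
  let ?h = "\<lambda>(i, j, k, l, m, n). (-1) ^ (n * (e - m)) * (nf_coeff p (i, j, k, l, m, n) * nf_coeff q (a - i, b - j, c - k, d - l, e - m, f - n))"
  let ?c = "\<lambda>(i, j, k, l, m, n). (a - i, b - j, c - k, d - l, e - m, f - n)"
  \<comment> \<open>The scalar is raised to an even power, and its square is
    \<open>(-1) ^ (m + n) = 1\<close>.\<close>
  have coc: "cocycle (i, j, k, l, m, n) (i', j', k', l', m', n') = (-1) ^ (n * m')"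
    if mn: "even (m + n)" and ij: "even (i' + j')" for i j k l m n i' j' k' l' m' n' :: nat
  proof -
    obtain t where t: "i' + j' = 2 * t" using ij by blast
    have "((-1) ^ l * (-\<i>) ^ m * \<i> ^ n)\<^sup>2 =
        ((-1) ^ l * (-1) ^ l) * ((-\<i>) ^ m * (-\<i>) ^ m) * (\<i> ^ n * \<i> ^ n)"
      by (simp only: power2_eq_square mult_ac)
    also have "\<dots> = (-1) ^ (m + n)"
      by (simp add: power_add flip: power_mult_distrib)
    also have "\<dots> = 1" using mn by simp
    finally have "((-1) ^ l * (-\<i>) ^ m * \<i> ^ n) ^ (i' + j') = 1"
      unfolding t power_mult by simp
    then show ?thesis by simp
  qed
  have mult_add: "expo_mult (i, j, k, l, m, n) (i', j', k', l', m', n') = (i + i', j + j', k + k', l + l', m + m', n + n')"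
    if "expo_neutral (i, j, k, l, m, n)" for i j k l m n i' j' k' l' m' n'
  proof -
    have "even (k + l + (m + n))" using that by simp
    then show ?thesis by (simp add: add.assoc)
  qed
  have "nf_coeff (p \<odot> q) M = sum ?g {(m1, m2). expo_mult m1 m2 = M}"
    by (rule nf_coeff_mul)
  also have "\<dots> = sum ?g ?T"
  proof (rule sum.mono_neutral_right[OF finite_expo_mult])
    show "\<forall>x\<in>{(m1, m2). expo_mult m1 m2 = M} - ?T. ?g x = 0"
    proof
      fix x assume x: "x \<in> {(m1, m2). expo_mult m1 m2 = M} - ?T"
      obtain m1 m2 where m: "x = (m1, m2)" by (cases x)
      with x have "\<not> expo_neutral m1 \<or> \<not> expo_neutral m2" by blast
      then show "?g x = 0" unfolding m split mult_eq_0_iff using p q by blast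
    qed
  qed blast
  also have "\<dots> = sum ?h {x \<in> ?P. expo_neutral x \<and> expo_neutral (?c x)}"
  proof (rule sum.reindex_bij_witness[of _ "\<lambda>x. (x, ?c x)" fst])
    fix x assume x: "x \<in> ?T"
    obtain m1 m2 where "x = (m1, m2)" by (cases x)
    moreover obtain i j k l m n where "m1 = (i, j, k, l, m, n)" by (cases m1 rule: prod_cases6)
    moreover obtain i' j' k' l' m' n' where "m2 = (i', j', k', l', m', n')" by (cases m2 rule: prod_cases6)
    ultimately have xe: "x = ((i, j, k, l, m, n), (i', j', k', l', m', n'))" by simp
    with x have ne: "expo_neutral (i, j, k, l, m, n)" "expo_neutral (i', j', k', l', m', n')"
      and em: "expo_mult (i, j, k, l, m, n) (i', j', k', l', m', n') = M" by blast+
    have par: "even (m + n)" "even (i' + j')" using ne by simp_all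
    have s: "a = i + i'" "b = j + j'" "c = k + k'" "d = l + l'" "e = m + m'" "f = n + n'"
      using em unfolding mult_add[OF ne(1)] M by simp_all
    have c: "?c (i, j, k, l, m, n) = (i', j', k', l', m', n')" by (simp add: s)
    show "(fst x, ?c (fst x)) = x" unfolding xe fst_conv c ..
    show "fst x \<in> {x \<in> ?P. expo_neutral x \<and> expo_neutral (?c x)}"
      unfolding xe fst_conv mem_Collect_eq c using ne by (simp add: s)
    show "?h (fst x) = ?g x"
      unfolding xe fst_conv split coc[OF par] by (simp add: s)
  next
    fix x assume x: "x \<in> {x \<in> ?P. expo_neutral x \<and> expo_neutral (?c x)}"
    obtain i j k l m n where xe: "x = (i, j, k, l, m, n)" by (cases x rule: prod_cases6)
    have "expo_neutral (i, j, k, l, m, n)" using x xe by blast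
    from mult_add[OF this] have "expo_mult x (?c x) = M"
      using x unfolding xe M by simp
    then show "(x, ?c x) \<in> ?T" using x by blast
  qed simp
  also have "\<dots> = sum ?h ?P"
  proof (rule sum.mono_neutral_left)
    show "\<forall>x\<in>?P - {x \<in> ?P. expo_neutral x \<and> expo_neutral (?c x)}. ?h x = 0"
    proof
      fix x assume x: "x \<in> ?P - {x \<in> ?P. expo_neutral x \<and> expo_neutral (?c x)}"
      obtain i j k l m n where eq: "x = (i, j, k, l, m, n)" by (cases x rule: prod_cases6)
      from x have "\<not> expo_neutral x \<or> \<not> expo_neutral (?c x)" by blast
      then show "?h x = 0" unfolding eq split mult_eq_0_iff using p q by blast
    qed
  qed auto
  also have "\<dots> = conv (nf_coeff p) (nf_coeff q) M"
    by (simp add: M sum.cartesian_product)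
  finally show "nf_coeff (p \<odot> q) M = conv (nf_coeff p) (nf_coeff q) M" .
qed

text \<open>Linear conditions shared by the generators and inherited by products; they express that there
  are no invariants in the degrees of \<open>x1 x2\<close> and \<open>y1\<^sup>2 z1\<^sup>2\<close>, and the symmetry under \<open>s\<close> in two further degrees.\<close>
definition admissible :: "(expo \<Rightarrow> complex) \<Rightarrow> bool" where
  "admissible F \<longleftrightarrow> (\<forall>m. \<not> expo_neutral m \<longrightarrow> F m = 0) \<and>
     F (1, 1, 0, 0, 0, 0) = 0 \<and> F (0, 0, 2, 0, 2, 0) = 0 \<and> F (0, 0, 2, 0, 0, 2) = 0 \<and>
     F (2, 0, 0, 0, 0, 2) = - F (2, 0, 0, 0, 2, 0) \<and> F (0, 0, 0, 0, 0, 4) = F (0, 0, 0, 0, 4, 0)"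

text \<open>The signs from 14 on oppose the symmetries in \<open>admissible\<close>: a sum where
  \<open>z1^2\<close> and \<open>z2^2\<close> have opposite coefficients, a difference where
  \<open>z1^4\<close> and \<open>z2^4\<close> have equal ones.\<close>

definition detect :: "nat \<Rightarrow> (expo \<Rightarrow> complex) \<Rightarrow> complex" where
  "detect n F =
    (if n = 1 then F (0, 0, 1, 1, 0, 0)
     else if n = 2 then F (0, 0, 0, 0, 1, 1)
     else if n = 3 then F (2, 2, 0, 0, 0, 0)
     else if n = 4 then F (4, 0, 0, 0, 0, 0)
     else if n = 5 then F (0, 0, 4, 0, 0, 0)
     else if n = 6 then F (0, 0, 0, 0, 4, 0)
     else if n = 7 then F (2, 0, 2, 0, 0, 0)
     else if n = 8 then F (2, 0, 0, 0, 2, 0)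
     else if n = 9 then F (5, 1, 0, 0, 0, 0)
     else if n = 10 then F (3, 1, 2, 0, 0, 0)
     else if n = 11 then F (3, 1, 0, 0, 2, 0)
     else if n = 12 then F (1, 1, 2, 0, 2, 0)
     else if n = 13 then F (1, 1, 2, 0, 0, 2)
     else if n = 14 then F (4, 0, 2, 0, 2, 0) + F (4, 0, 2, 0, 0, 2)
     else if n = 15 then F (2, 0, 4, 0, 2, 0) + F (2, 0, 4, 0, 0, 2)
     else if n = 16 then F (2, 0, 2, 0, 4, 0) - F (2, 0, 2, 0, 0, 4)
     else F (0, 0, 4, 0, 4, 0) - F (0, 0, 4, 0, 0, 4))"

lemma expo_neutral_add:
  assumes "expo_neutral (i, j, k, l, m, n)" "expo_neutral (a - i, b - j, c - k, d - l, e - m, f - n)"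
    "i \<le> a" "j \<le> b" "k \<le> c" "l \<le> d" "m \<le> e" "n \<le> f"
  shows "expo_neutral (a, b, c, d, e, f)"
proof -
  obtain a' b' c' d' e' f' where eq: "a = i + a'" "b = j + b'" "c = k + c'" "d = l + d'" "e = m + e'" "f = n + f'"
    using assms(3-8) by (metis le_add_diff_inverse)
  have half: "(x + x' + (y + y')) div 2 = (x + y) div 2 + (x' + y') div 2" "even (x + x' + (y + y'))"
    if "even (x + y)" "even (x' + y')" for x x' y y' :: nat
  proof -
    obtain s t where "x + y = 2 * s" "x' + y' = 2 * t" using \<open>even (x + y)\<close> \<open>even (x' + y')\<close> by (elim evenE)
    then have e: "x + y = 2 * s" "x' + y' = 2 * t" "x + x' + (y + y') = 2 * (s + t)" by simp_all
    show "(x + x' + (y + y')) div 2 = (x + y) div 2 + (x' + y') div 2" "even (x + x' + (y + y'))"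
      unfolding e by simp_all
  qed
  show ?thesis
    using assms(1,2) unfolding eq by (simp add: half del: even_add) (simp only: even_add, argo)
qed

lemma conv_neutral:
  assumes "admissible F" "admissible G" "\<not> expo_neutral m"
  shows "conv F G m = 0"
proof -
  obtain a b c d e f where m: "m = (a, b, c, d, e, f)" by (cases m rule: prod_cases6)
  have "F (i, j, k, l, m, n) * G (a - i, b - j, c - k, d - l, e - m, f - n) = 0"
    if "i \<le> a" "j \<le> b" "k \<le> c" "l \<le> d" "m \<le> e" "n \<le> f" for i j k l m n
    using expo_neutral_add[of i j k l m n a b c d e f] that assms m unfolding admissible_def mult_eq_0_iff by metis
  then show ?thesis unfolding m by (auto intro!: sum.neutral)
qed

text \<open>The bound 5 is the largest exponent in \<open>detect\<close>, reached for
  \<open>g9\<close>.\<close>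

lemma sum_atMost_numeral:
  "(\<Sum>i\<le>(1::nat). h i) = h 0 + h 1" "(\<Sum>i\<le>(2::nat). h i) = h 0 + h 1 + h 2"
  "(\<Sum>i\<le>(3::nat). h i) = h 0 + h 1 + h 2 + h 3" "(\<Sum>i\<le>(4::nat). h i) = h 0 + h 1 + h 2 + h 3 + h 4"
  "(\<Sum>i\<le>(5::nat). h i) = h 0 + h 1 + h 2 + h 3 + h 4 + h 5" for h :: "nat \<Rightarrow> complex"
  by (simp_all add: eval_nat_numeral)

lemma admissible_simps:
  assumes "admissible F"
  shows "\<not> expo_neutral m \<Longrightarrow> F m = 0" "F (1, 1, 0, 0, 0, 0) = 0" "F (0, 0, 2, 0, 2, 0) = 0" "F (0, 0, 2, 0, 0, 2) = 0"
     "F (2, 0, 0, 0, 0, 2) = - F (2, 0, 0, 0, 2, 0)" "F (0, 0, 0, 0, 0, 4) = F (0, 0, 0, 0, 4, 0)"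
  using assms unfolding admissible_def by blast+

text \<open>In the degrees of the linear conditions a neutral exponent splits into neutral ones only
  trivially, so there the product is a linear combination of \<open>F\<close> and
  \<open>G\<close>.\<close>

lemma admissible_conv:
  assumes "admissible F" "admissible G"
  shows "admissible (conv F G)"
  unfolding admissible_def
  using conv_neutral[OF assms]
  by (simp add: sum_atMost_numeral[simplified] admissible_simps[OF assms(1), simplified] admissible_simps[OF assms(2), simplified])

text \<open>A Leibniz rule at the augmentation. A nontrivial neutral splitting contains a value that
  \<open>admissible\<close> makes 0, or it has a counterpart in the second coefficient with which it
  cancels.\<close>

lemma detect_conv:
  assumes "admissible F" "admissible G"
  shows "detect n (conv F G) = F (0, 0, 0, 0, 0, 0) * detect n G + detect n F * G (0, 0, 0, 0, 0, 0)"
  unfolding detect_def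
  by (simp add: sum_atMost_numeral[simplified] admissible_simps[OF assms(1), simplified] admissible_simps[OF assms(2), simplified] algebra_simps)

section \<open>Separating the seventeen generators\<close>

definition monomial :: "expo \<Rightarrow> expo \<Rightarrow> complex" where
  "monomial m n = (if m = n then 1 else 0)"

lemma nf_coeff_sorted_word: "word_coef w = 1 \<Longrightarrow> nf_coeff (fa_word w) m = monomial (word_expo w) m"
  by (simp add: nf_coeff_word monomial_def)

text \<open>In each generator as written, at most \<open>x1\<close> and \<open>x2\<close> are out of
  order, and these commute; so all words have \<open>word_coef\<close> 1.\<close>

lemma nf_coeff_gB:
  "nf_coeff (gB 1) m = monomial (0, 0, 1, 1, 0, 0) m"
  "nf_coeff (gB 2) m = monomial (0, 0, 0, 0, 1, 1) m"
  "nf_coeff (gB 3) m = monomial (2, 2, 0, 0, 0, 0) m"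
  "nf_coeff (gB 4) m = monomial (4, 0, 0, 0, 0, 0) m + monomial (0, 4, 0, 0, 0, 0) m"
  "nf_coeff (gB 5) m = monomial (0, 0, 4, 0, 0, 0) m + monomial (0, 0, 0, 4, 0, 0) m"
  "nf_coeff (gB 6) m = monomial (0, 0, 0, 0, 4, 0) m + monomial (0, 0, 0, 0, 0, 4) m"
  "nf_coeff (gB 7) m = monomial (2, 0, 2, 0, 0, 0) m - monomial (2, 0, 0, 2, 0, 0) m - monomial (0, 2, 2, 0, 0, 0) m + monomial (0, 2, 0, 2, 0, 0) m"
  "nf_coeff (gB 8) m = monomial (2, 0, 0, 0, 2, 0) m - monomial (2, 0, 0, 0, 0, 2) m + monomial (0, 2, 0, 0, 2, 0) m - monomial (0, 2, 0, 0, 0, 2) m"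
  "nf_coeff (gB 9) m = monomial (5, 1, 0, 0, 0, 0) m - monomial (1, 5, 0, 0, 0, 0) m"
  "nf_coeff (gB 10) m = monomial (3, 1, 2, 0, 0, 0) m - monomial (3, 1, 0, 2, 0, 0) m + monomial (1, 3, 2, 0, 0, 0) m - monomial (1, 3, 0, 2, 0, 0) m"
  "nf_coeff (gB 11) m = monomial (3, 1, 0, 0, 2, 0) m - monomial (3, 1, 0, 0, 0, 2) m - monomial (1, 3, 0, 0, 2, 0) m + monomial (1, 3, 0, 0, 0, 2) m"
  "nf_coeff (gB 12) m = monomial (1, 1, 2, 0, 2, 0) m + monomial (1, 1, 0, 2, 0, 2) m"
  "nf_coeff (gB 13) m = monomial (1, 1, 2, 0, 0, 2) m + monomial (1, 1, 0, 2, 2, 0) m"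
  "nf_coeff (gB 14) m = monomial (4, 0, 2, 0, 0, 2) m + monomial (4, 0, 0, 2, 2, 0) m - monomial (0, 4, 2, 0, 0, 2) m - monomial (0, 4, 0, 2, 2, 0) m"
  "nf_coeff (gB 15) m = monomial (2, 0, 4, 0, 0, 2) m - monomial (2, 0, 0, 4, 2, 0) m + monomial (0, 2, 4, 0, 0, 2) m - monomial (0, 2, 0, 4, 2, 0) m"
  "nf_coeff (gB 16) m = monomial (2, 0, 2, 0, 0, 4) m - monomial (2, 0, 0, 2, 4, 0) m - monomial (0, 2, 2, 0, 0, 4) m + monomial (0, 2, 0, 2, 4, 0) m"
  "nf_coeff (gB 17) m = monomial (0, 0, 4, 0, 0, 4) m + monomial (0, 0, 0, 4, 4, 0) m"
  unfolding gB_def fa_pow_2_4 fa_var_word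
  by (simp_all add: fa_word_mul fa_mul_distrib nf_coeff_add nf_coeff_diff nf_coeff_sorted_word)
     (simp_all add: eval_nat_numeral)

lemma atLeastAtMost_1_17: "{1..17::nat} = {1, 2, 3, 4, 5, 6, 7, 8, 9, 10, 11, 12, 13, 14, 15, 16, 17}"
  by (auto simp: eval_nat_numeral le_Suc_eq)

lemma monomial_neutral: "expo_neutral m \<Longrightarrow> \<not> expo_neutral n \<Longrightarrow> monomial m n = 0"
  by (auto simp: monomial_def)

lemma admissible_gB:
  assumes "n \<in> {1..17}"
  shows "admissible (nf_coeff (gB n))"
proof -
  have "nf_coeff (gB n) m = 0" if "\<not> expo_neutral m" for m
    using assms that unfolding atLeastAtMost_1_17
    by (elim insertE emptyE) (simp_all only: nf_coeff_gB, simp_all add: monomial_neutral del: split_paired_All)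
  then show ?thesis
    using assms unfolding atLeastAtMost_1_17 admissible_def
    by (elim insertE emptyE) (simp_all add: nf_coeff_gB monomial_def del: One_nat_def)
qed

text \<open>The matrix of the functionals on the generators is diagonal, with \<open>-1\<close> at
  16 and 17 and \<open>1\<close> elsewhere.\<close>

lemma detect_gB:
  assumes "n \<in> {1..17}" "k \<in> {1..17}"
  shows "detect n (nf_coeff (gB k)) = 0 \<longleftrightarrow> n \<noteq> k"
  using assms unfolding atLeastAtMost_1_17
  by (elim insertE emptyE) (simp_all add: detect_def nf_coeff_gB monomial_def del: One_nat_def)

lemma admissible_add: "admissible F \<Longrightarrow> admissible G \<Longrightarrow> admissible (\<lambda>m. F m + G m)"
  unfolding admissible_def by (simp del: split_paired_All)

lemma detect_add: "detect n (\<lambda>m. F m + G m) = detect n F + detect n G"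
  by (simp add: detect_def)

text \<open>Admissibility belongs to the induction, since the Leibniz rule needs it for both
  factors.\<close>

lemma detect_fa_alg:
  assumes "n \<in> {1..17}" "q \<in> fa_alg (gB ` ({1..17} - {n}))"
  shows "admissible (nf_coeff q) \<and> detect n (nf_coeff q) = 0"
  using assms(2)
proof (induction rule: fa_alg.induct)
  case (const c)
  show ?case by (auto simp: admissible_def detect_def nf_coeff_const)
next
  case (gen s)
  then show ?case using admissible_gB detect_gB[OF assms(1)] by auto
next
  case (add p q)
  have "nf_coeff (p \<oplus> q) = (\<lambda>m. nf_coeff p m + nf_coeff q m)"
    by (simp add: nf_coeff_add fun_eq_iff)
  then show ?case
    using add.IH by (simp add: admissible_add detect_add)
next
  case (mul p q)
  then have "nf_coeff (p \<odot> q) = conv (nf_coeff p) (nf_coeff q)"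
    by (intro nf_coeff_mul_conv) (simp_all add: admissible_simps(1))
  then show ?case
    using mul.IH by (simp add: admissible_conv detect_conv)
qed

lemma fa_alg_mono: "S \<subseteq> T \<Longrightarrow> q \<in> fa_alg S \<Longrightarrow> q \<in> fa_alg T"
  by (rotate_tac, induction rule: fa_alg.induct) (auto intro: fa_alg.intros)

theorem mainTheorem11:
  shows "B_subalg (gB ` {1..17}) = B_invariants
         \<and> (\<forall>S. S \<subset> {1..17} \<longrightarrow> B_subalg (gB ` S) \<noteq> B_invariants)"
proof (intro conjI allI impI)
  fix S :: "nat set" assume S: "S \<subset> {1..17}"
  then obtain n where n: "n \<in> {1..17}" "S \<subseteq> {1..17} - {n}" by blast
  show "B_subalg (gB ` S) \<noteq> B_invariants"
  proof
    assume "B_subalg (gB ` S) = B_invariants"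
    moreover have "gB n \<in> B_subalg (gB ` {1..17})"
      using n(1) by (auto simp: B_subalg_def intro!: bexI[of _ "gB n"] B_eq_refl fa_alg.gen)
    ultimately obtain q where q: "q \<in> fa_alg (gB ` S)" "B_eq (gB n) q"
      unfolding B_subalg_eq_invariants by (auto simp: B_subalg_def)
    from q(1) n(2) have "q \<in> fa_alg (gB ` ({1..17} - {n}))"
      using fa_alg_mono image_mono by metis
    then have "detect n (nf_coeff q) = 0"
      using detect_fa_alg[OF n(1)] by blast
    then show False
      using detect_gB[OF n(1) n(1)] nf_coeff_B_eq[OF q(2)] by simp
  qed
qed (rule B_subalg_eq_invariants)

end
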